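(* Let $\lambda_1,\lambda_2,\lambda_3\in\mathbb{C}^\times$ and let $(\rho,V)$, $V=\mathbb{C}^3$, be the representation of $\mathcal{B}_3$ given by $\rho(\sigma_1)=A$, $\rho(\sigma_2)=B$, where $$A=\begin{pmatrix}\lambda_1&\lambda_1\lambda_3\lambda_2^{-1}+\lambda_2&\lambda_2\\0&\lambda_2&\lambda_2\\0&0&\lambda_3\end{pmatrix},\qquad B=\begin{pmatrix}\lambda_3&0&0\\-\lambda_2&\lambda_2&0\\\lambda_2&-\lambda_1\lambda_3\lambda_2^{-1}-\lambda_2&\lambda_1\end{pmatrix}.$$ Then $\rho$ extends to $\mathcal{LB}_3$, and for any extension (still denoted $\rho$) either (a) $\rho(s_1s_2)=S=\gamma^{-2}AB$ where $\gamma^3=\lambda_1\lambda_2\lambda_3$, and $\rho(s_1)=MS_1M^{-1}$ where $S_1=\begin{pmatrix}\pm1&0&0\\0&0&\alpha\\0&\frac1\alpha&0\end{pmatrix}$ with $\alpha\in\mathbb{C}^\times$, and $M\in\mathrm{GL}(V)$ is any matrix such that $\gamma^{-2}M^{-1}ABM=\mathrm{diag}(1,\omega,\omega^2)$; or (b) $\rho(s_1s_2)=S\neq kAB$ for all $k\in\mathbb{C}$, $(\lambda_1+\lambda_2)(\lambda_1+\lambda_3)(\lambda_2+\lambda_3)=0$, and $\rho$ factors over $\mathcal{SLB}_3$. In this case, after permuting the eigenvalues $\lambda_1,\lambda_2,\lambda_3$ if necessary, we have $$\rho(s_1s_2)=\begin{pmatrix}0&0&z\\0&z&z\\-\frac1{z^2}&\frac{1-z^3}{z^2}&-z\end{pmatrix}\quad\text{and}\quad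 \rho(s_1)=\pm\begin{pmatrix}1&z-1&z\\0&z&z\\0&\frac{1-z^2}{z}&-z\end{pmatrix},$$ where $z\in\mathbb{C}^\times$ is a free parameter.
   Context: $\mathcal{B}_3=\langle \sigma_1,\sigma_2 : \sigma_1\sigma_2\sigma_1=\sigma_2\sigma_1\sigma_2\rangle$ is the braid group. The three component loop braid group $\mathcal{LB}_3$ is the group generated by $\sigma_1,\sigma_2,s_1,s_2$ with relations $\sigma_1\sigma_2\sigma_1=\sigma_2\sigma_1\sigma_2$; $s_1s_2s_1=s_2s_1s_2$; $s_1^2=s_2^2=1$; $s_1s_2\sigma_1=\sigma_2s_1s_2$; $\sigma_1\sigma_2s_1=s_2\sigma_1\sigma_2$. The symmetric loop braid group $\mathcal{SLB}_3$ is the quotient of $\mathcal{LB}_3$ by the additional relation $\sigma_2\sigma_1s_2=s_1\sigma_2\sigma_1$. An extension of a representation $\rho$ of $\mathcal{B}_3$ on $V$ to $\mathcal{LB}_3$ is a representation of $\mathcal{LB}_3$ on the same space with the same values on $\sigma_1,\sigma_2$. $\omega$ is a primitive third root of unity. By Tuba and Wenzl, the matrices $A,B$ above define a representation of $\mathcal{B}_3$, every irreducible three dimensional complex representation of $\mathcal{B}_3$ is equivalent to one of this form, and two irreducible ones are isomorphic if and only if their sets of eigenvalues $\{\lambda_1,\lambda_2,\lambda_3\}$ (of the image of $\sigma_1$) coincide; "permuting the eigenvalues" means replacing $(\lambda_1,\lambda_2,\lambda_3)$ by a permutation in the matrices $A,B$.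
   Formalization: The explicit matrices with parameter z in (b) are claimed only when ρ is irreducible; in case (b) this excludes only eigenvalues {x,x,−x}, where the formula fails, e.g. (−1,1,1) with ρ(s₁s₂)=AB(1+tE₂₃), t≠0. *)

theory Defs
  imports "HOL-Analysis.Analysis" "HOL-Algebra.Group" "HOL-Library.Multiset"
begin

section \<open>Groups given by generators and relations\<close>

text \<open>A word is a list of letters; \<open>(x, True)\<close> stands for the generator \<open>x\<close> and \<open>(x, False)\<close>
  for its formal inverse.  A relation \<open>u = v\<close> is the pair \<open>(u, v)\<close>.\<close>

type_synonym 'x word = "('x \<times> bool) list"

inductive pres_eq :: "('x word \<times> 'x word) set \<Rightarrow> 'x word \<Rightarrow> 'x word \<Rightarrow> bool"
  for R where
  refl: "pres_eq R u u"
| sym: "pres_eq R u v \<Longrightarrow> pres_eq R v u"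
| trans: "pres_eq R u v \<Longrightarrow> pres_eq R v w \<Longrightarrow> pres_eq R u w"
| mult: "pres_eq R u v \<Longrightarrow> pres_eq R (x @ u @ y) (x @ v @ y)"
| cancel: "pres_eq R [(a, b), (a, \<not> b)] []"
| rel: "(u, v) \<in> R \<Longrightarrow> pres_eq R u v"

definition pres_class :: "('x word \<times> 'x word) set \<Rightarrow> 'x word \<Rightarrow> 'x word set" where
  "pres_class R u = {v. pres_eq R u v}"

text \<open>The group generated by all elements of the type \<open>'x\<close> subject to the relations in \<open>R\<close>.\<close>

definition presented_group :: "('x word \<times> 'x word) set \<Rightarrow> 'x word set monoid" where
  "presented_group R =
     \<lparr>carrier = range (pres_class R),
      mult = (\<lambda>U V. {w. \<exists>u\<in>U. \<exists>v\<in>V. pres_eq R (u @ v) w}),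
      one = pres_class R []\<rparr>"

abbreviation letter :: "'x \<Rightarrow> 'x word" where
  "letter x \<equiv> [(x, True)]"

lemma pres_eq_append:
  assumes "pres_eq R u u'" "pres_eq R v v'"
  shows "pres_eq R (u @ v) (u' @ v')"
proof -
  have "pres_eq R (u @ v) (u' @ v)"
    using pres_eq.mult[OF assms(1), of "[]" v] by simp
  moreover have "pres_eq R (u' @ v) (u' @ v')"
    using pres_eq.mult[OF assms(2), of u' "[]"] by simp
  ultimately show ?thesis by (rule pres_eq.trans)
qed

lemma pres_class_eq_iff: "pres_class R u = pres_class R v \<longleftrightarrow> pres_eq R u v"
  unfolding pres_class_def
  by (auto intro: pres_eq.refl pres_eq.sym pres_eq.trans)

lemma presented_group_mult:
  "pres_class R u \<otimes>\<^bsub>presented_group R\<^esub> pres_class R v = pres_class R (u @ v)"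
  unfolding presented_group_def pres_class_def
  by (auto intro: pres_eq.refl pres_eq.trans pres_eq_append)

definition word_inverse :: "'x word \<Rightarrow> 'x word" where
  "word_inverse u = map (\<lambda>(a, b). (a, \<not> b)) (rev u)"

lemma pres_eq_word_inverse: "pres_eq R (word_inverse u @ u) []"
proof (induction u)
  case Nil
  show ?case by (simp add: word_inverse_def pres_eq.refl)
next
  case (Cons p u)
  obtain a b where p: "p = (a, b)" by (cases p)
  have "pres_eq R (word_inverse u @ [(a, \<not> b), (a, \<not> \<not> b)] @ u) (word_inverse u @ [] @ u)"
    by (intro pres_eq.mult pres_eq.cancel)
  then show ?case
    using Cons.IH by (auto simp: p word_inverse_def intro: pres_eq.trans)
qed

lemma group_presented_group: "group (presented_group R)"
proof (rule groupI)
  fix U assume "U \<in> carrier (presented_group R)"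
  then obtain u where u: "U = pres_class R u" by (auto simp: presented_group_def)
  have "pres_class R (word_inverse u) \<in> carrier (presented_group R)"
    by (simp add: presented_group_def)
  moreover have "pres_class R (word_inverse u) \<otimes>\<^bsub>presented_group R\<^esub> U = \<one>\<^bsub>presented_group R\<^esub>"
    unfolding u presented_group_mult
    by (simp add: presented_group_def pres_class_eq_iff pres_eq_word_inverse)
  ultimately show "\<exists>V\<in>carrier (presented_group R). V \<otimes>\<^bsub>presented_group R\<^esub> U = \<one>\<^bsub>presented_group R\<^esub>"
    by blast
next
  have carrier: "carrier (presented_group R) = range (pres_class R)"
    and one: "\<one>\<^bsub>presented_group R\<^esub> = pres_class R []"
    by (simp_all add: presented_group_def)
  show "\<one>\<^bsub>presented_group R\<^esub> \<in> carrier (presented_group R)"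
    by (simp add: carrier one)
  show "\<one>\<^bsub>presented_group R\<^esub> \<otimes>\<^bsub>presented_group R\<^esub> U = U"
    if "U \<in> carrier (presented_group R)" for U
    using that by (auto simp: carrier one presented_group_mult)
  show "U \<otimes>\<^bsub>presented_group R\<^esub> V \<in> carrier (presented_group R)"
    if "U \<in> carrier (presented_group R)" "V \<in> carrier (presented_group R)" for U V
    using that by (auto simp: carrier presented_group_mult)
  show "U \<otimes>\<^bsub>presented_group R\<^esub> V \<otimes>\<^bsub>presented_group R\<^esub> W =
        U \<otimes>\<^bsub>presented_group R\<^esub> (V \<otimes>\<^bsub>presented_group R\<^esub> W)"
    if "U \<in> carrier (presented_group R)" "V \<in> carrier (presented_group R)"
       "W \<in> carrier (presented_group R)" for U V W
    using that by (auto simp: carrier presented_group_mult)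
qed

fun eval_word :: "('g, 'm) monoid_scheme \<Rightarrow> ('x \<Rightarrow> 'g) \<Rightarrow> 'x word \<Rightarrow> 'g" where
  "eval_word G f [] = \<one>\<^bsub>G\<^esub>"
| "eval_word G f ((a, b) # u) = (if b then f a else inv\<^bsub>G\<^esub> f a) \<otimes>\<^bsub>G\<^esub> eval_word G f u"

text \<open>Von Dyck's theorem: the universal property of the presentation.\<close>

lemma presented_group_universal:
  fixes G (structure)
  assumes G: "group G" and f: "\<And>x. f x \<in> carrier G"
    and R: "\<And>u v. (u, v) \<in> R \<Longrightarrow> eval_word G f u = eval_word G f v"
  shows "\<exists>h \<in> hom (presented_group R) G. \<forall>u. h (pres_class R u) = eval_word G f u"
proof -
  interpret group G by (rule G)
  have closed: "eval_word G f u \<in> carrier G" for u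
    by (induction u) (auto simp: f)
  have app: "eval_word G f (u @ v) = eval_word G f u \<otimes> eval_word G f v" for u v
    by (induction u) (auto simp: f closed m_assoc)
  have resp: "eval_word G f u = eval_word G f v" if "pres_eq R u v" for u v
    using that
  proof induction
    case (cancel a b)
    then show ?case by (cases b) (simp_all add: f)
  qed (auto simp: app R)
  define h where "h U = eval_word G f (SOME u. u \<in> U)" for U
  have h: "h (pres_class R u) = eval_word G f u" for u
  proof -
    have "(SOME v. v \<in> pres_class R u) \<in> pres_class R u"
      by (rule someI[of _ u]) (simp add: pres_class_def pres_eq.refl)
    then show ?thesis unfolding h_def by (simp add: pres_class_def resp)
  qed
  have "h \<in> hom (presented_group R) G"
    by (rule homI) (auto simp: presented_group_def[of R, THEN arg_cong[where f = carrier], simplified]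
        presented_group_mult h app closed)
  with h show ?thesis by blast
qed


section \<open>The braid group and the loop braid groups\<close>

datatype braid_gen = B\<sigma>1 | B\<sigma>2

definition braid_rels :: "(braid_gen word \<times> braid_gen word) set" where
  "braid_rels =
     {(letter B\<sigma>1 @ letter B\<sigma>2 @ letter B\<sigma>1, letter B\<sigma>2 @ letter B\<sigma>1 @ letter B\<sigma>2)}"

definition B3 :: "braid_gen word set monoid" where
  "B3 = presented_group braid_rels"

definition b3_gen :: "braid_gen \<Rightarrow> braid_gen word set" where
  "b3_gen x = pres_class braid_rels (letter x)"

datatype loop_braid_gen = L\<sigma>1 | L\<sigma>2 | Ls1 | Ls2

definition loop_braid_rels :: "(loop_braid_gen word \<times> loop_braid_gen word) set" where
  "loop_braid_rels =
     {(letter L\<sigma>1 @ letter L\<sigma>2 @ letter L\<sigma>1, letter L\<sigma>2 @ letter L\<sigma>1 @ letter L\<sigma>2),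
      (letter Ls1 @ letter Ls2 @ letter Ls1, letter Ls2 @ letter Ls1 @ letter Ls2),
      (letter Ls1 @ letter Ls1, []),
      (letter Ls2 @ letter Ls2, []),
      (letter Ls1 @ letter Ls2 @ letter L\<sigma>1, letter L\<sigma>2 @ letter Ls1 @ letter Ls2),
      (letter L\<sigma>1 @ letter L\<sigma>2 @ letter Ls1, letter Ls2 @ letter L\<sigma>1 @ letter L\<sigma>2)}"

definition LB3 :: "loop_braid_gen word set monoid" where
  "LB3 = presented_group loop_braid_rels"

definition lb3_gen :: "loop_braid_gen \<Rightarrow> loop_braid_gen word set" where
  "lb3_gen x = pres_class loop_braid_rels (letter x)"

definition sym_loop_braid_rels :: "(loop_braid_gen word \<times> loop_braid_gen word) set" where
  "sym_loop_braid_rels = loop_braid_rels \<union>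
     {(letter L\<sigma>2 @ letter L\<sigma>1 @ letter Ls2, letter Ls1 @ letter L\<sigma>2 @ letter L\<sigma>1)}"

definition SLB3 :: "loop_braid_gen word set monoid" where
  "SLB3 = presented_group sym_loop_braid_rels"


section \<open>Matrix representations\<close>

definition GL :: "('a::field^'n^'n) monoid" where
  "GL = \<lparr>carrier = {M. invertible M}, mult = (**), one = mat 1\<rparr>"

lemma group_GL: "group (GL :: ('a::field^'n^'n) monoid)"
proof (rule groupI)
  fix M :: "'a^'n^'n" assume "M \<in> carrier GL"
  then obtain N where "M ** N = mat 1" "N ** M = mat 1"
    by (auto simp: GL_def invertible_def)
  then show "\<exists>N\<in>carrier GL. N \<otimes>\<^bsub>GL\<^esub> M = \<one>\<^bsub>GL\<^esub>"
    by (auto simp: GL_def invertible_def)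
qed (auto simp: GL_def invertible_mult matrix_mul_assoc intro: invertible_def[THEN iffD2] exI[of _ "mat 1"])

text \<open>\<open>\<tau>\<close> is a representation of \<open>LB3\<close> extending the representation \<open>\<rho>\<close> of \<open>B3\<close>.\<close>

definition extends_to_LB3 ::
  "(braid_gen word set \<Rightarrow> 'a::field^'n^'n) \<Rightarrow> (loop_braid_gen word set \<Rightarrow> 'a^'n^'n) \<Rightarrow> bool" where
  "extends_to_LB3 \<rho> \<tau> \<longleftrightarrow> \<tau> \<in> hom LB3 GL \<and>
     \<tau> (lb3_gen L\<sigma>1) = \<rho> (b3_gen B\<sigma>1) \<and> \<tau> (lb3_gen L\<sigma>2) = \<rho> (b3_gen B\<sigma>2)"

text \<open>\<open>\<tau>\<close> is the composition of the projection from \<open>LB3\<close> to \<open>SLB3\<close>, which maps the class of a word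
  to the class of the same word, with a representation of \<open>SLB3\<close>.\<close>

definition factors_over_SLB3 :: "(loop_braid_gen word set \<Rightarrow> 'a::field^'n^'n) \<Rightarrow> bool" where
  "factors_over_SLB3 \<tau> \<longleftrightarrow> (\<exists>\<phi> \<in> hom SLB3 GL. \<forall>w.
     \<tau> (pres_class loop_braid_rels w) = \<phi> (pres_class sym_loop_braid_rels w))"

definition irreducible_rep :: "('g, 'm) monoid_scheme \<Rightarrow> ('g \<Rightarrow> 'a::field^'n^'n) \<Rightarrow> bool" where
  "irreducible_rep G \<rho> \<longleftrightarrow> (\<forall>W. vec.subspace W \<and> (\<forall>g\<in>carrier G. \<forall>w\<in>W. \<rho> g *v w \<in> W)
     \<longrightarrow> W = {0} \<or> W = UNIV)"

definition conj_rep :: "'a::field^'n^'n \<Rightarrow> ('g \<Rightarrow> 'a^'n^'n) \<Rightarrow> 'g \<Rightarrow> 'a^'n^'n" where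
  "conj_rep N \<rho> g = matrix_inv N ** \<rho> g ** N"


section \<open>The matrices\<close>

definition mat_scale :: "'a::times \<Rightarrow> 'a^'n^'m \<Rightarrow> 'a^'n^'m" (infixl \<open>*\<^sub>m\<close> 70) where
  "k *\<^sub>m M = (\<chi> i. k *s (M $ i))"

definition TW_A :: "complex \<Rightarrow> complex \<Rightarrow> complex \<Rightarrow> complex^3^3" where
  "TW_A l1 l2 l3 = vector
     [vector [l1, l1 * l3 / l2 + l2, l2],
      vector [0, l2, l2],
      vector [0, 0, l3]]"

definition TW_B :: "complex \<Rightarrow> complex \<Rightarrow> complex \<Rightarrow> complex^3^3" where
  "TW_B l1 l2 l3 = vector
     [vector [l3, 0, 0],
      vector [- l2, l2, 0],
      vector [l2, - (l1 * l3 / l2) - l2, l1]]"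

definition is_TW_rep ::
  "complex \<Rightarrow> complex \<Rightarrow> complex \<Rightarrow> (braid_gen word set \<Rightarrow> complex^3^3) \<Rightarrow> bool" where
  "is_TW_rep l1 l2 l3 \<rho> \<longleftrightarrow> \<rho> \<in> hom B3 GL \<and>
     \<rho> (b3_gen B\<sigma>1) = TW_A l1 l2 l3 \<and> \<rho> (b3_gen B\<sigma>2) = TW_B l1 l2 l3"

definition diag3 :: "complex \<Rightarrow> complex \<Rightarrow> complex \<Rightarrow> complex^3^3" where
  "diag3 a b c = vector [vector [a, 0, 0], vector [0, b, 0], vector [0, 0, c]]"

definition S1_mat :: "complex \<Rightarrow> complex \<Rightarrow> complex^3^3" where
  "S1_mat \<epsilon> \<alpha> = vector
     [vector [\<epsilon>, 0, 0],
      vector [0, 0, \<alpha>],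
      vector [0, 1 / \<alpha>, 0]]"

definition sym_s1s2_mat :: "complex \<Rightarrow> complex^3^3" where
  "sym_s1s2_mat z = vector
     [vector [0, 0, z],
      vector [0, z, z],
      vector [- (1 / z^2), (1 - z^3) / z^2, - z]]"

definition sym_s1_mat :: "complex \<Rightarrow> complex^3^3" where
  "sym_s1_mat z = vector
     [vector [1, z - 1, z],
      vector [0, z, z],
      vector [0, (1 - z^2) / z, - z]]"

lemma TW_rep_exists:
  assumes "l1 \<noteq> 0" "l2 \<noteq> 0" "l3 \<noteq> 0"
  shows "\<exists>\<rho>. is_TW_rep l1 l2 l3 \<rho>"
proof -
  define f where "f x = (case x of B\<sigma>1 \<Rightarrow> TW_A l1 l2 l3 | B\<sigma>2 \<Rightarrow> TW_B l1 l2 l3)" for x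
  have det: "det (TW_A l1 l2 l3) = l1 * l2 * l3" "det (TW_B l1 l2 l3) = l1 * l2 * l3"
    by (simp_all add: det_3 TW_A_def TW_B_def)
  have f: "f x \<in> carrier GL" for x
    using assms by (cases x) (auto simp: f_def GL_def invertible_det_nz det)
  have braid: "TW_A l1 l2 l3 ** (TW_B l1 l2 l3 ** TW_A l1 l2 l3) =
      TW_B l1 l2 l3 ** (TW_A l1 l2 l3 ** TW_B l1 l2 l3)"
    using assms
    by (simp add: TW_A_def TW_B_def vec_eq_iff forall_3 matrix_matrix_mult_def sum_3 field_simps)
  have "\<exists>\<rho> \<in> hom (presented_group braid_rels) GL.
      \<forall>u. \<rho> (pres_class braid_rels u) = eval_word GL f u"
  proof (rule presented_group_universal[OF group_GL f])
    fix u v assume "(u, v) \<in> braid_rels"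
    then show "eval_word GL f u = eval_word GL f v"
      by (auto simp: braid_rels_def f_def GL_def braid)
  qed
  then show ?thesis
    by (auto simp: is_TW_rep_def B3_def b3_gen_def f_def GL_def)
qed

end

theory Submission
  imports Defs
begin

text \<open>Write \<open>A\<close>, \<open>B\<close>, \<open>s\<close>, \<open>S\<close> for the images of \<open>\<sigma>\<^sub>1\<close>, \<open>\<sigma>\<^sub>2\<close>, \<open>s\<^sub>1\<close>, \<open>s\<^sub>1 s\<^sub>2\<close>, and put \<open>C = A B\<close>.
  The relations say that \<open>E = C\<^sup>-\<^sup>1 S\<close> commutes with both \<open>A\<close> and \<open>s\<close>.  If \<open>E\<close> is scalar, then
  \<open>S\<close> is diagonalizable with eigenvalues the cube roots of unity, and \<open>s S s = S\<^sup>-\<^sup>1\<close> means that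
  the involution \<open>s\<close> preserves the eigenline for \<open>1\<close> and swaps the other two.  Conversely any such
  \<open>s\<close> gives an extension.

  Otherwise, \<open>A\<close> being cyclic unless \<open>A\<^sup>2\<close> is scalar, \<open>E = a + b A + c A\<^sup>2\<close>.  Since \<open>S\<close> has order three
  and is conjugate to its inverse, its trace vanishes, which forces \<open>b = 0\<close>; hence \<open>s\<close> commutes
  with \<open>A\<^sup>2\<close>.  As \<open>B A\<^sup>2 B\<close> is a multiple of \<open>A\<^sup>-\<^sup>2\<close>, this is the symmetric relation.  If no two
  eigenvalues were opposite, \<open>tr S\<^sup>2 = 0\<close> would give \<open>a = 0\<close>, and comparing the traces of \<open>S A\<^sup>2\<close>
  and \<open>s S A\<^sup>2 s = S\<^sup>2 A\<^sup>2\<close> would give \<open>c = 0\<close>.  When two eigenvalues are opposite, an explicit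
  intertwiner, invertible by irreducibility, moves them to the last two places, where
  \<open>a C + c C A\<^sup>2\<close> and the matrices \<open>s\<close> commuting with \<open>A\<^sup>2\<close> can be read off.\<close>

section \<open>Representations of the loop braid group by matrices\<close>

text \<open>Complements the universal property: a homomorphism is determined by the images of the
  generators, so words become products of matrices and relations become matrix identities.\<close>

lemma hom_presented_group_eq_eval_word:
  fixes G (structure)
  assumes G: "group G" and h: "h \<in> hom (presented_group R) G"
  shows "h (pres_class R w) = eval_word G (\<lambda>x. h (pres_class R (letter x))) w"
proof -
  interpret group_hom "presented_group R" G h
    by (simp add: G group_hom_axioms_def group_hom_def group_presented_group h)
  have closed: "pres_class R u \<in> carrier (presented_group R)" for u
    by (simp add: presented_group_def)
  have one: "\<one>\<^bsub>presented_group R\<^esub> = pres_class R []"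
    by (simp add: presented_group_def)
  have inv: "inv\<^bsub>presented_group R\<^esub> pres_class R (letter a) = pres_class R [(a, False)]" for a
  proof (rule G.inv_equality)
    show "pres_class R [(a, False)] \<otimes>\<^bsub>presented_group R\<^esub> pres_class R (letter a) = \<one>\<^bsub>presented_group R\<^esub>"
      using pres_eq.cancel[of R a False] by (simp add: presented_group_mult one pres_class_eq_iff)
  qed (rule closed)+
  show ?thesis
  proof (induction w)
    case Nil
    then show ?case by (simp flip: one)
  next
    case (Cons p w)
    obtain a b where p: "p = (a, b)" by (cases p)
    have "pres_class R (p # w) = pres_class R [p] \<otimes>\<^bsub>presented_group R\<^esub> pres_class R w"
      by (simp add: presented_group_mult)
    then have "h (pres_class R (p # w)) = h (pres_class R [p]) \<otimes> h (pres_class R w)"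
      by (simp add: closed)
    also have "h (pres_class R [p]) =
        (if b then h (pres_class R (letter a)) else inv h (pres_class R (letter a)))"
      using hom_inv[OF closed[of "letter a"]] by (simp add: p inv)
    finally show ?case by (simp add: p Cons.IH)
  qed
qed

lemma GL_simps [simp]:
  "X \<otimes>\<^bsub>GL\<^esub> Y = X ** Y" "\<one>\<^bsub>GL\<^esub> = mat 1" "X \<in> carrier GL \<longleftrightarrow> invertible X"
  by (simp_all add: GL_def)

lemma
  assumes "invertible X"
  shows matrix_inv_mult_right: "X ** matrix_inv X = mat 1"
    and matrix_inv_mult_left: "matrix_inv X ** X = mat 1"
  using someI_ex[OF assms[unfolded invertible_def]] by (simp_all add: matrix_inv_def)

lemma invertible_matrix_inv:
  fixes X :: "'a::field^'n^'n"
  assumes "invertible X"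
  shows "invertible (matrix_inv X)"
  using matrix_inv_mult_left[OF assms] matrix_inv_mult_right[OF assms] by (auto simp: invertible_def)

lemma GL_inv:
  fixes X :: "'a::field^'n^'n"
  assumes "invertible X"
  shows "inv\<^bsub>GL\<^esub> X = matrix_inv X"
  by (rule group.inv_equality[OF group_GL])
    (use assms in \<open>simp_all add: matrix_inv_mult_left invertible_matrix_inv\<close>)

text \<open>Matrix form of a representation of the loop braid group, with \<open>S\<close> in the role of
  \<open>s\<^sub>1 s\<^sub>2\<close>, so that \<open>s\<^sub>2 = s S\<close>.\<close>

definition loop_braid_relations ::
  "'a::field^'n^'n \<Rightarrow> 'a^'n^'n \<Rightarrow> 'a^'n^'n \<Rightarrow> 'a^'n^'n \<Rightarrow> bool" where
  "loop_braid_relations A B s S \<longleftrightarrow> s ** s = mat 1 \<and> S ** S ** S = mat 1 \<and>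
     s ** S ** s ** S = mat 1 \<and> S ** A = B ** S \<and> A ** B ** s = s ** S ** A ** B"

lemma LB3_hom_generator:
  assumes "\<tau> \<in> hom LB3 GL"
  shows "invertible (\<tau> (lb3_gen x))"
  using assms unfolding hom_def LB3_def lb3_gen_def presented_group_def by auto

lemma loop_braid_relations_if_extends:
  fixes \<rho> :: "braid_gen word set \<Rightarrow> 'a::field^'n^'n"
  assumes "extends_to_LB3 \<rho> \<tau>"
  shows "loop_braid_relations (\<rho> (b3_gen B\<sigma>1)) (\<rho> (b3_gen B\<sigma>2)) (\<tau> (lb3_gen Ls1))
    (\<tau> (lb3_gen Ls1 \<otimes>\<^bsub>LB3\<^esub> lb3_gen Ls2))"
    and "\<tau> (lb3_gen Ls1 \<otimes>\<^bsub>LB3\<^esub> lb3_gen Ls2) = \<tau> (lb3_gen Ls1) ** \<tau> (lb3_gen Ls2)"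
    and "\<tau> (lb3_gen Ls2) = \<tau> (lb3_gen Ls1) ** \<tau> (lb3_gen Ls1 \<otimes>\<^bsub>LB3\<^esub> lb3_gen Ls2)"
proof -
  define e where "e x = \<tau> (lb3_gen x)" for x
  have hom: "\<tau> \<in> hom (presented_group loop_braid_rels) GL"
    and \<sigma>: "e L\<sigma>1 = \<rho> (b3_gen B\<sigma>1)" "e L\<sigma>2 = \<rho> (b3_gen B\<sigma>2)"
    using assms by (simp_all add: extends_to_LB3_def LB3_def e_def)
  have ev: "\<tau> (pres_class loop_braid_rels w) = eval_word GL e w" for w
    unfolding e_def[abs_def] lb3_gen_def by (rule hom_presented_group_eq_eval_word[OF group_GL hom])
  have rel: "eval_word GL e u = eval_word GL e v" if "(u, v) \<in> loop_braid_rels" for u v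
    using pres_eq.rel[OF that] ev pres_class_eq_iff by metis
  have S: "\<tau> (lb3_gen Ls1 \<otimes>\<^bsub>LB3\<^esub> lb3_gen Ls2) = e Ls1 ** e Ls2"
    by (simp add: LB3_def lb3_gen_def presented_group_mult ev)
  then show "\<tau> (lb3_gen Ls1 \<otimes>\<^bsub>LB3\<^esub> lb3_gen Ls2) = \<tau> (lb3_gen Ls1) ** \<tau> (lb3_gen Ls2)"
    by (simp add: e_def)
  have r: "e Ls1 ** e Ls2 ** e Ls1 = e Ls2 ** e Ls1 ** e Ls2"
    "e Ls1 ** e Ls1 = mat 1" "e Ls2 ** e Ls2 = mat 1"
    "e Ls1 ** e Ls2 ** e L\<sigma>1 = e L\<sigma>2 ** e Ls1 ** e Ls2"
    "e L\<sigma>1 ** e L\<sigma>2 ** e Ls1 = e Ls2 ** e L\<sigma>1 ** e L\<sigma>2"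
    using rel[of "letter Ls1 @ letter Ls2 @ letter Ls1" "letter Ls2 @ letter Ls1 @ letter Ls2"]
      rel[of "letter Ls1 @ letter Ls1" "[]"] rel[of "letter Ls2 @ letter Ls2" "[]"]
      rel[of "letter Ls1 @ letter Ls2 @ letter L\<sigma>1" "letter L\<sigma>2 @ letter Ls1 @ letter Ls2"]
      rel[of "letter L\<sigma>1 @ letter L\<sigma>2 @ letter Ls1" "letter Ls2 @ letter L\<sigma>1 @ letter L\<sigma>2"]
    by (simp_all add: loop_braid_rels_def matrix_mul_assoc)
  have s2: "e Ls1 ** (e Ls1 ** e Ls2) = e Ls2"
    by (simp add: matrix_mul_assoc r(2))
  then show "\<tau> (lb3_gen Ls2) = \<tau> (lb3_gen Ls1) ** \<tau> (lb3_gen Ls1 \<otimes>\<^bsub>LB3\<^esub> lb3_gen Ls2)"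
    using S by (simp add: e_def)
  \<comment> \<open>By the braid relation of s1 and s2, (s1 s2)^3 is the square of s1 s2 s1, which
    collapses since both are involutions.\<close>
  have "(e Ls1 ** e Ls2) ** (e Ls1 ** e Ls2) ** (e Ls1 ** e Ls2) =
      (e Ls1 ** e Ls2 ** e Ls1) ** (e Ls2 ** e Ls1 ** e Ls2)"
    by (simp add: matrix_mul_assoc)
  also have "\<dots> = e Ls1 ** e Ls2 ** ((e Ls1 ** e Ls1) ** e Ls2) ** e Ls1"
    by (simp only: r(1)[symmetric]) (simp add: matrix_mul_assoc)
  also have "\<dots> = mat 1"
    by (simp add: r) (simp add: r flip: matrix_mul_assoc)
  finally have "(e Ls1 ** e Ls2) ** (e Ls1 ** e Ls2) ** (e Ls1 ** e Ls2) = mat 1" .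
  moreover have "e Ls1 ** (e Ls1 ** e Ls2) ** e Ls1 ** (e Ls1 ** e Ls2) = mat 1"
  proof -
    have "e Ls1 ** (e Ls1 ** e Ls2) ** e Ls1 ** (e Ls1 ** e Ls2) =
        (e Ls1 ** (e Ls1 ** e Ls2)) ** (e Ls1 ** (e Ls1 ** e Ls2))"
      by (simp add: matrix_mul_assoc)
    then show ?thesis by (simp add: s2 r)
  qed
  ultimately have "loop_braid_relations (e L\<sigma>1) (e L\<sigma>2) (e Ls1) (e Ls1 ** e Ls2)"
    using r s2 by (simp add: loop_braid_relations_def matrix_mul_assoc)
  then show "loop_braid_relations (\<rho> (b3_gen B\<sigma>1)) (\<rho> (b3_gen B\<sigma>2)) (\<tau> (lb3_gen Ls1))
    (\<tau> (lb3_gen Ls1 \<otimes>\<^bsub>LB3\<^esub> lb3_gen Ls2))"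
    using S \<sigma> by (simp add: e_def)
qed

lemma extends_if_loop_braid_relations:
  fixes \<rho> :: "braid_gen word set \<Rightarrow> 'a::field^'n^'n"
  defines "A \<equiv> \<rho> (b3_gen B\<sigma>1)" and "B \<equiv> \<rho> (b3_gen B\<sigma>2)"
  assumes rels: "loop_braid_relations A B s S"
    and inv: "invertible A" "invertible B" and braid: "A ** B ** A = B ** A ** B"
  shows "\<exists>\<tau>. extends_to_LB3 \<rho> \<tau> \<and> \<tau> (lb3_gen Ls1 \<otimes>\<^bsub>LB3\<^esub> lb3_gen Ls2) = S \<and> \<tau> (lb3_gen Ls1) = s"
proof -
  have r: "s ** s = mat 1" "S ** S ** S = mat 1" "s ** S ** s ** S = mat 1"
    "S ** A = B ** S" "A ** B ** s = s ** S ** A ** B"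
    using rels by (simp_all add: loop_braid_relations_def)
  define f where "f x = (case x of L\<sigma>1 \<Rightarrow> A | L\<sigma>2 \<Rightarrow> B | Ls1 \<Rightarrow> s | Ls2 \<Rightarrow> s ** S)" for x
  have t2: "(s ** S) ** (s ** S) = mat 1"
    using r(3) by (simp add: matrix_mul_assoc)
  have "invertible s" "invertible (s ** S)"
    using r(1) t2 by (auto simp: invertible_def)
  then have f: "f x \<in> carrier GL" for x
    using inv by (cases x) (simp_all add: f_def)
  have ss: "s ** (s ** X) = X" for X
    by (simp add: matrix_mul_assoc r(1))
  \<comment> \<open>Inserting \<open>S ** S ** S = mat 1\<close> exposes the trivial factor
    \<open>s ** S ** s ** S\<close>.\<close>
  have "s ** (S ** s) = s ** S ** s ** (S ** S ** S)"
    by (simp add: r(2) matrix_mul_assoc)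
  also have "\<dots> = S ** S"
    by (simp add: matrix_mul_assoc r(3))
  finally have sSs: "s ** (S ** s) = S ** S" .
  \<comment> \<open>With \<open>s ** S\<close> in the role of s2, this is s1 s2 s1 = s2 s1
    s2.\<close>
  have sts: "s ** (s ** S ** s) = s ** S ** (s ** (s ** S))"
  proof -
    have "s ** (s ** S ** s) = S ** s" using ss by (simp flip: matrix_mul_assoc)
    also have "\<dots> = s ** (s ** (S ** s))" by (simp add: ss)
    also have "\<dots> = s ** S ** (s ** (s ** S))" by (simp add: sSs ss) (simp add: matrix_mul_assoc)
    finally show ?thesis .
  qed
  have "\<exists>\<tau> \<in> hom (presented_group loop_braid_rels) GL.
      \<forall>u. \<tau> (pres_class loop_braid_rels u) = eval_word GL f u"
  proof (rule presented_group_universal[OF group_GL f])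
    fix u v assume "(u, v) \<in> loop_braid_rels"
    then show "eval_word GL f u = eval_word GL f v"
      using sts t2 braid r ss by (auto simp: loop_braid_rels_def f_def matrix_mul_assoc)
  qed
  then obtain \<tau> where \<tau>: "\<tau> \<in> hom LB3 GL"
    and ev: "\<And>u. \<tau> (pres_class loop_braid_rels u) = eval_word GL f u"
    unfolding LB3_def by auto
  have "extends_to_LB3 \<rho> \<tau>"
    using \<tau> by (simp add: extends_to_LB3_def lb3_gen_def ev f_def A_def B_def)
  moreover have "\<tau> (lb3_gen Ls1 \<otimes>\<^bsub>LB3\<^esub> lb3_gen Ls2) = S" "\<tau> (lb3_gen Ls1) = s"
    by (simp_all add: LB3_def lb3_gen_def presented_group_mult ev f_def ss)
  ultimately show ?thesis by blast
qed

section \<open>Change of basis, the symmetric quotient and irreducibility\<close>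

lemma conj_rep_hom:
  assumes "h \<in> hom G GL" "invertible N"
  shows "conj_rep N h \<in> hom G GL"
proof (rule homI)
  fix x y assume xy: "x \<in> carrier G" "y \<in> carrier G"
  have "matrix_inv N ** h x ** N ** (matrix_inv N ** h y ** N) =
      matrix_inv N ** h x ** (N ** matrix_inv N) ** h y ** N"
    by (simp add: matrix_mul_assoc)
  then show "conj_rep N h (x \<otimes>\<^bsub>G\<^esub> y) = conj_rep N h x \<otimes>\<^bsub>GL\<^esub> conj_rep N h y"
    using hom_mult[OF assms(1) xy]
    by (simp add: conj_rep_def matrix_inv_mult_right[OF assms(2)] matrix_mul_assoc)
next
  fix x assume "x \<in> carrier G"
  then show "conj_rep N h x \<in> carrier GL"
    using hom_in_carrier[OF assms(1), of x] assms(2)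
    by (simp add: conj_rep_def invertible_mult invertible_matrix_inv)
qed

lemma extends_conj_rep:
  assumes "extends_to_LB3 \<rho> \<tau>" "invertible N"
  shows "extends_to_LB3 (conj_rep N \<rho>) (conj_rep N \<tau>)"
  using assms conj_rep_hom[of \<tau> LB3 N] by (simp add: extends_to_LB3_def) (simp add: conj_rep_def)

lemma conj_rep_eq_if_intertwines:
  assumes "invertible N" "\<rho> g ** N = N ** X"
  shows "conj_rep N \<rho> g = X"
proof -
  have "matrix_inv N ** (\<rho> g ** N) = X"
    by (simp add: assms(2) matrix_mul_assoc matrix_inv_mult_left[OF assms(1)])
  then show ?thesis by (simp add: conj_rep_def matrix_mul_assoc)
qed

text \<open>By von Dyck's theorem only relations between the images of the generators matter; those
  of \<open>LB3\<close> hold already, which leaves \<open>rel\<close>.\<close>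

lemma factors_over_SLB3_if:
  fixes \<tau> :: "loop_braid_gen word set \<Rightarrow> 'a::field^'n^'n"
  assumes \<tau>: "\<tau> \<in> hom LB3 GL"
    and rel: "\<tau> (lb3_gen L\<sigma>2) ** \<tau> (lb3_gen L\<sigma>1) ** \<tau> (lb3_gen Ls2) =
      \<tau> (lb3_gen Ls1) ** \<tau> (lb3_gen L\<sigma>2) ** \<tau> (lb3_gen L\<sigma>1)"
  shows "factors_over_SLB3 \<tau>"
proof -
  define e where "e x = \<tau> (lb3_gen x)" for x
  have ev: "\<tau> (pres_class loop_braid_rels w) = eval_word GL e w" for w
    unfolding e_def[abs_def] lb3_gen_def
    by (rule hom_presented_group_eq_eval_word[OF group_GL \<tau>[unfolded LB3_def]])
  have "\<exists>\<phi> \<in> hom (presented_group sym_loop_braid_rels) GL.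
      \<forall>u. \<phi> (pres_class sym_loop_braid_rels u) = eval_word GL e u"
  proof (rule presented_group_universal[OF group_GL])
    show "e x \<in> carrier GL" for x
      using LB3_hom_generator[OF \<tau>] by (simp add: e_def)
    show "eval_word GL e u = eval_word GL e v" if "(u, v) \<in> sym_loop_braid_rels" for u v
    proof (cases "(u, v) \<in> loop_braid_rels")
      case True
      then show ?thesis by (metis pres_eq.rel pres_class_eq_iff ev)
    next
      case False
      then show ?thesis using that rel
        by (auto simp: sym_loop_braid_rels_def e_def matrix_mul_assoc)
    qed
  qed
  then obtain \<phi> where "\<phi> \<in> hom SLB3 GL"
    and "\<And>u. \<phi> (pres_class sym_loop_braid_rels u) = eval_word GL e u"
    by (auto simp: SLB3_def)
  then show ?thesis by (auto simp: factors_over_SLB3_def ev intro!: bexI[of _ \<phi>])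
qed

text \<open>One half of Schur's lemma: the range of \<open>N\<close> is invariant and not zero,
  hence everything. It makes a change of basis invertible and, with scalar \<open>A\<close> and
  \<open>B\<close>, excludes common eigenvectors.\<close>

lemma invertible_if_intertwines_irreducible:
  fixes \<rho> :: "braid_gen word set \<Rightarrow> 'a::field^'n^'n" and N :: "'a^'n^'n"
  assumes irr: "irreducible_rep B3 \<rho>" and \<rho>: "\<rho> \<in> hom B3 GL"
    and "\<rho> (b3_gen B\<sigma>1) ** N = N ** A" "\<rho> (b3_gen B\<sigma>2) ** N = N ** B"
    and "invertible A" "invertible B" and "N \<noteq> 0"
  shows "invertible N"
proof -
  define e where "e x = \<rho> (b3_gen x)" for x
  have ev: "\<rho> (pres_class braid_rels w) = eval_word GL e w" for w
    unfolding e_def[abs_def] b3_gen_def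
    by (rule hom_presented_group_eq_eval_word[OF group_GL \<rho>[unfolded B3_def]])
  have "pres_class braid_rels u \<in> carrier B3" for u
    by (simp add: B3_def presented_group_def)
  then have inv_e: "invertible (e x)" for x
    using hom_in_carrier[OF \<rho>, of "b3_gen x"] by (simp add: e_def b3_gen_def)
  have "\<exists>X. invertible X \<and> e x ** N = N ** X" for x
    using assms by (cases x) (auto simp: e_def)
  then obtain X where X: "\<And>x. invertible (X x)" "\<And>x. e x ** N = N ** X x"
    by metis
  have X': "matrix_inv (e x) ** N = N ** matrix_inv (X x)" for x
  proof -
    have "matrix_inv (e x) ** (e x ** N) ** matrix_inv (X x) =
        matrix_inv (e x) ** N ** (X x ** matrix_inv (X x))"
      by (simp add: X(2) matrix_mul_assoc)
    then show ?thesis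
      by (simp add: X(1) inv_e matrix_inv_mult_left matrix_inv_mult_right matrix_mul_assoc)
  qed
  \<comment> \<open>Pushing \<open>N\<close> through one letter at a time, inverse letters by
    \<open>X'\<close>, makes the range of \<open>N\<close> stable under the whole group.\<close>
  have word: "\<exists>Y. eval_word GL e u ** N = N ** Y" for u
  proof (induction u)
    case Nil
    then show ?case by (auto intro: exI[of _ "mat 1"])
  next
    case (Cons p u)
    then obtain Y where Y: "eval_word GL e u ** N = N ** Y" by blast
    obtain a b where p: "p = (a, b)" by (cases p)
    have "eval_word GL e (p # u) ** N = (if b then e a else matrix_inv (e a)) ** (N ** Y)"
      by (simp add: p GL_inv[OF inv_e] Y flip: matrix_mul_assoc)
    also have "\<dots> = N ** ((if b then X a else matrix_inv (X a)) ** Y)"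
      by (simp add: matrix_mul_assoc X(2) X')
    finally show ?case by blast
  qed
  have "vec.subspace (range ((*v) N))"
    by (rule vec.subspace_UNIV[THEN vec.subspace_image])
  moreover have "\<rho> g *v w \<in> range ((*v) N)" if g: "g \<in> carrier B3" and "w \<in> range ((*v) N)" for g w
  proof -
    obtain u v where "g = pres_class braid_rels u" and w: "w = N *v v"
      using g \<open>w \<in> range ((*v) N)\<close> by (auto simp: B3_def presented_group_def)
    then show ?thesis
      using word[of u] by (auto simp: ev matrix_vector_mul_assoc) (simp flip: matrix_vector_mul_assoc)
  qed
  ultimately have "range ((*v) N) = {0} \<or> range ((*v) N) = UNIV"
    using irr by (simp add: irreducible_rep_def)
  moreover have "range ((*v) N) \<noteq> {0}"
  proof
    assume "range ((*v) N) = {0}"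
    then have "N *v x = 0" for x by blast
    then have "N = 0" by (metis matrix_eq matrix_vector_mult_0)
    with \<open>N \<noteq> 0\<close> show False ..
  qed
  ultimately have "surj ((*v) N)" by blast
  then show ?thesis
    by (simp only: invertible_right_inverse matrix_right_invertible_surjective)
qed

section \<open>Matrices of size three\<close>

abbreviation mat3 ::
  "'a::zero \<Rightarrow> 'a \<Rightarrow> 'a \<Rightarrow> 'a \<Rightarrow> 'a \<Rightarrow> 'a \<Rightarrow> 'a \<Rightarrow> 'a \<Rightarrow> 'a \<Rightarrow> 'a^3^3" where
  "mat3 a b c d e f g h i \<equiv> vector [vector [a, b, c], vector [d, e, f], vector [g, h, i]]"

lemma mat3_mult:
  "(mat3 a b c d e f g h i :: 'a::comm_ring_1^3^3) ** mat3 a' b' c' d' e' f' g' h' i' =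
   mat3 (a * a' + b * d' + c * g') (a * b' + b * e' + c * h') (a * c' + b * f' + c * i')
        (d * a' + e * d' + f * g') (d * b' + e * e' + f * h') (d * c' + e * f' + f * i')
        (g * a' + h * d' + i * g') (g * b' + h * e' + i * h') (g * c' + h * f' + i * i')"
  by (simp add: vec_eq_iff forall_3 matrix_matrix_mult_def sum_3)

lemma mat3_eq_iff:
  "(mat3 a b c d e f g h i :: 'a::zero^3^3) = mat3 a' b' c' d' e' f' g' h' i' \<longleftrightarrow>
   a = a' \<and> b = b' \<and> c = c' \<and> d = d' \<and> e = e' \<and> f = f' \<and> g = g' \<and> h = h' \<and> i = i'"
  by (auto simp: vec_eq_iff forall_3)

lemma mat3_add:
  "(mat3 a b c d e f g h i :: 'a::comm_ring_1^3^3) + mat3 a' b' c' d' e' f' g' h' i' =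
   mat3 (a + a') (b + b') (c + c') (d + d') (e + e') (f + f') (g + g') (h + h') (i + i')"
  by (simp add: vec_eq_iff forall_3)

lemma mat_scale_mat3:
  "k *\<^sub>m (mat3 a b c d e f g h i :: 'a::comm_ring_1^3^3) =
   mat3 (k * a) (k * b) (k * c) (k * d) (k * e) (k * f) (k * g) (k * h) (k * i)"
  by (simp add: vec_eq_iff forall_3 mat_scale_def)

lemma mat_1_mat3: "mat 1 = (mat3 1 0 0 0 1 0 0 0 1 :: 'a::comm_ring_1^3^3)"
  by (simp add: vec_eq_iff forall_3 mat_def)

lemma zero_mat3: "0 = (mat3 0 0 0 0 0 0 0 0 0 :: 'a::zero^3^3)"
  by (simp add: vec_eq_iff forall_3)

lemma trace_mat3: "trace (mat3 a b c d e f g h i :: 'a::comm_ring_1^3^3) = a + e + i"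
  by (simp add: trace_def sum_3)

lemma det_mat3:
  "det (mat3 a b c d e f g h i :: 'a::comm_ring_1^3^3) =
   a * e * i + b * f * g + c * d * h - a * f * h - b * d * i - c * e * g"
  by (simp add: det_3)

lemma mat3_cases:
  obtains a b c d e f g h i where "(X :: 'a::zero^3^3) = mat3 a b c d e f g h i"
proof
  show "X = mat3 (X$1$1) (X$1$2) (X$1$3) (X$2$1) (X$2$2) (X$2$3) (X$3$1) (X$3$2) (X$3$3)"
    by (simp add: vec_eq_iff forall_3)
qed

lemmas mat3_simps = mat3_mult mat3_eq_iff mat3_add mat_scale_mat3 mat_1_mat3 trace_mat3

lemma mat_scale_nth [simp]: "(k *\<^sub>m X) $ i $ j = k * X $ i $ j"
  by (simp add: mat_scale_def)

lemma mat_scale_mult_left: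
  fixes X :: "'a::comm_ring_1^'n^'m"
  shows "(k *\<^sub>m X) ** Y = k *\<^sub>m (X ** Y)"
  by (simp add: vec_eq_iff matrix_matrix_mult_def sum_distrib_left mult.assoc)

lemma mat_scale_mult_right:
  fixes X :: "'a::comm_ring_1^'n^'m"
  shows "X ** (k *\<^sub>m Y) = k *\<^sub>m (X ** Y)"
  by (simp add: vec_eq_iff matrix_matrix_mult_def sum_distrib_left mult_ac)

lemma matrix_add_rdistrib: "(X + Y) ** Z = X ** Z + Y ** (Z :: 'a::semiring_1^'n^'m)"
  by (simp add: vec_eq_iff matrix_matrix_mult_def sum.distrib algebra_simps)

lemma mat_scale_scale: "k *\<^sub>m (l *\<^sub>m X) = (k * l) *\<^sub>m (X :: 'a::comm_ring_1^'n^'m)"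
  by (simp add: vec_eq_iff mult.assoc)

lemma mat_scale_1 [simp]: "1 *\<^sub>m X = (X :: 'a::comm_ring_1^'n^'m)"
  by (simp add: vec_eq_iff)

lemma mat_scale_cancel:
  "k \<noteq> 0 \<Longrightarrow> k *\<^sub>m X = k *\<^sub>m Y \<longleftrightarrow> X = (Y :: 'a::field^'n^'m)"
  by (auto simp: vec_eq_iff)

lemma trace_scale: "trace (k *\<^sub>m X) = k * trace (X :: 'a::comm_ring_1^'n^'n)"
  by (simp add: trace_def sum_distrib_left)

section \<open>Cancellation, Cayley--Hamilton and commutants\<close>

lemma invertible_mult_cancel_left:
  fixes X :: "'a::field^'n^'n"
  assumes "invertible X" "X ** Y = X ** Z"
  shows "Y = Z"
  by (metis assms matrix_inv_mult_left matrix_mul_assoc matrix_mul_lid)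

text \<open>The coefficient of \<open>X\<close> is the second elementary symmetric function of the
  eigenvalues, expressed by traces because the traces of \<open>S\<close> and \<open>S ** S\<close>
  are what the group relations control.\<close>

lemma Cayley_Hamilton_3:
  fixes X :: "'a::field_char_0^3^3"
  shows "X ** X ** X + ((trace X ^ 2 - trace (X ** X)) / 2) *\<^sub>m X =
    trace X *\<^sub>m (X ** X) + det X *\<^sub>m mat 1"
proof (cases X rule: mat3_cases)
  case (1 a b c d e f g h i)
  have t: "(trace X ^ 2 - trace (X ** X)) / 2 = a * e + a * i + e * i - b * d - c * g - f * h"
    unfolding 1 mat3_simps by (simp add: field_simps power2_eq_square)
  show ?thesis unfolding t unfolding 1 mat3_simps det_mat3
    by (intro conjI; algebra)
qed

text \<open>\<open>E\<close> and \<open>F\<close> agree on \<open>v\<close>, \<open>A *v v\<close>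
  and \<open>A *v (A *v v)\<close>, which form a basis by \<open>cyc\<close>.\<close>

lemma commutes_eq_if_cyclic:
  fixes A :: "'a::field^3^3"
  assumes E: "A ** E = E ** A" and F: "A ** F = F ** A" and v: "E *v v = F *v v"
    and cyc: "det (vector [v, A *v v, A *v (A *v v)]) \<noteq> 0"
  shows "E = F"
proof -
  define K :: "'a^3^3" where "K = vector [v, A *v v, A *v (A *v v)]"
  have AE: "E *v (A *v u) = A *v (E *v u)" "F *v (A *v u) = A *v (F *v u)" for u
    by (simp_all add: matrix_vector_mul_assoc E F)
  have row: "E *v (K $ i) = F *v (K $ i)" for i
    using exhaust_3[of i] by (auto simp: K_def v AE)
  have "K ** transpose E = K ** transpose F"
    using row by (simp add: vec_eq_iff matrix_matrix_mult_def matrix_vector_mult_def transpose_def mult.commute)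
  then have "transpose E = transpose F"
    using cyc invertible_mult_cancel_left invertible_det_nz unfolding K_def by blast
  then show ?thesis by (metis transpose_transpose)
qed

text \<open>The coefficients are the coordinates of \<open>E *v v\<close> in the basis given by
  \<open>cyc\<close>: the polynomial in \<open>A\<close> built from them commutes with
  \<open>A\<close> and agrees with \<open>E\<close> on \<open>v\<close>.\<close>

lemma commutant_cyclic:
  fixes A :: "'a::field^3^3"
  assumes E: "A ** E = E ** A"
    and cyc: "det (vector [v, A *v v, A *v (A *v v)]) \<noteq> 0"
  shows "\<exists>a b c. E = a *\<^sub>m mat 1 + b *\<^sub>m A + c *\<^sub>m (A ** A)"
proof -
  define K :: "'a^3^3" where "K = transpose (vector [v, A *v v, A *v (A *v v)])"
  have "invertible K"
    using cyc by (simp add: K_def invertible_det_nz)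
  then obtain w where w: "K *v w = E *v v"
    by (metis matrix_inv_mult_right matrix_vector_mul_assoc matrix_vector_mul_lid)
  define F where "F = w $ 1 *\<^sub>m mat 1 + w $ 2 *\<^sub>m A + w $ 3 *\<^sub>m (A ** A)"
  have scale: "(k *\<^sub>m X) *v u = k *s (X *v u)" for k and X :: "'a^3^3" and u
    by (simp add: vec_eq_iff matrix_vector_mult_def sum_distrib_left mult.assoc)
  have "F *v v = w $ 1 *s v + w $ 2 *s (A *v v) + w $ 3 *s (A *v (A *v v))"
    by (simp add: F_def matrix_vector_mult_add_rdistrib scale matrix_vector_mul_assoc)
  also have "\<dots> = K *v w"
    by (simp add: K_def vec_eq_iff matrix_vector_mult_def sum_3 transpose_def mult.commute)
  finally have "E *v v = F *v v" using w by simp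
  moreover have "A ** F = F ** A"
    by (simp add: F_def matrix_add_ldistrib matrix_add_rdistrib mat_scale_mult_left
        mat_scale_mult_right matrix_mul_assoc)
  ultimately have "E = F" using commutes_eq_if_cyclic[OF E _ _ cyc] by blast
  then show ?thesis unfolding F_def by blast
qed

section \<open>The Tuba--Wenzl matrices\<close>

text \<open>Writing \<open>q m\<close> for the first eigenvalue and \<open>m\<close> for the second removes all divisions.\<close>

lemma TW_A_mat3: "m \<noteq> 0 \<Longrightarrow> TW_A (q * m) m l = mat3 (q * m) (q * l + m) m 0 m m 0 0 l"
  by (simp add: TW_A_def)

lemma TW_B_mat3: "m \<noteq> 0 \<Longrightarrow> TW_B (q * m) m l = mat3 l 0 0 (- m) m 0 m (- (q * l) - m) (q * m)"
  by (simp add: TW_B_def)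

lemma TW_AB_mat3:
  "m \<noteq> 0 \<Longrightarrow> TW_A (q * m) m l ** TW_B (q * m) m l =
    mat3 0 0 (q * m^2) 0 (- q * m * l) (q * m^2) (m * l) (- l * (q * l + m)) (q * m * l)"
  unfolding TW_A_mat3 TW_B_mat3 mat3_simps by (simp add: algebra_simps power2_eq_square)

lemma TW_AA_mat3:
  "m \<noteq> 0 \<Longrightarrow> TW_A (q * m) m l ** TW_A (q * m) m l =
    mat3 (q^2 * m^2) ((q * m + m) * (q * l + m)) (m * (q * m + q * l + m + l))
      0 (m^2) (m * (m + l)) 0 0 (l^2)"
  unfolding TW_A_mat3 mat3_simps by (simp add: algebra_simps power2_eq_square)

lemma obtain_ratio:
  assumes "(l1 :: 'a::field) \<noteq> 0" "l2 \<noteq> 0"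
  obtains q where "l1 = q * l2" "q \<noteq> 0"
  using assms by (intro that[of "l1 / l2"]) auto

lemma
  assumes "l1 \<noteq> 0" "l2 \<noteq> 0" "l3 \<noteq> 0"
  shows invertible_TW_A: "invertible (TW_A l1 l2 l3)"
    and invertible_TW_B: "invertible (TW_B l1 l2 l3)"
    and TW_braid: "TW_A l1 l2 l3 ** TW_B l1 l2 l3 ** TW_A l1 l2 l3 =
      TW_B l1 l2 l3 ** TW_A l1 l2 l3 ** TW_B l1 l2 l3"
proof -
  obtain q where q: "l1 = q * l2" "q \<noteq> 0" using assms obtain_ratio by blast
  show "invertible (TW_A l1 l2 l3)" "invertible (TW_B l1 l2 l3)"
    using assms q by (simp_all add: invertible_det_nz TW_A_mat3 TW_B_mat3 det_mat3)
  show "TW_A l1 l2 l3 ** TW_B l1 l2 l3 ** TW_A l1 l2 l3 =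
      TW_B l1 l2 l3 ** TW_A l1 l2 l3 ** TW_B l1 l2 l3"
    unfolding q(1) TW_A_mat3[OF assms(2)] TW_B_mat3[OF assms(2)] mat3_simps
    by (simp add: algebra_simps)
qed

text \<open>The element (\<sigma>1 \<sigma>2)^3 is central in the braid group, so a scalar is to be
  expected; comparing entries confirms it.\<close>

lemma TW_AB_cube:
  fixes l1 l2 l3 :: complex
  assumes "l1 \<noteq> 0" "l2 \<noteq> 0"
  defines "C \<equiv> TW_A l1 l2 l3 ** TW_B l1 l2 l3"
  shows "C ** C ** C = (l1 * l2 * l3)^2 *\<^sub>m mat 1"
proof -
  obtain q where q: "l1 = q * l2" using assms obtain_ratio by blast
  show ?thesis unfolding C_def q(1) TW_AB_mat3[OF assms(2)] mat3_simps
    by (intro conjI; algebra)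
qed

text \<open>These are the traces met when \<open>S\<close> is \<open>C\<close> times a polynomial of
  degree two in \<open>A\<close>; the factor \<open>D\<close> vanishes exactly when two of the
  eigenvalues are opposite.\<close>

lemma TW_traces:
  fixes l1 l2 l3 :: complex
  assumes "l1 \<noteq> 0" "l2 \<noteq> 0"
  defines "A \<equiv> TW_A l1 l2 l3" and "C \<equiv> TW_A l1 l2 l3 ** TW_B l1 l2 l3"
    and "D \<equiv> (l1 + l2) * (l1 + l3) * (l2 + l3)"
  shows "trace C = 0" "trace (C ** C) = 0" "trace (C ** A) = - l1 * l2 * l3" "trace (C ** (A ** A)) = 0"
    "trace (C ** (A ** A) ** (A ** A)) = l1 * l2 * l3 * D"
    "trace (C ** C ** (A ** A)) = l1 * l2 * l3 * D"
    "trace (C ** (A ** A) ** (C ** (A ** A))) = 0"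
    "trace (C ** (A ** A) ** (C ** (A ** A)) ** (A ** A)) = 0"
proof -
  obtain q where q: "l1 = q * l2" using assms obtain_ratio by blast
  note d = A_def C_def D_def q TW_AB_mat3[OF assms(2)] TW_AA_mat3[OF assms(2)] mat3_simps
  show "trace C = 0" unfolding d by algebra
  show "trace (C ** C) = 0" unfolding d by algebra
  show "trace (C ** (A ** A)) = 0" unfolding d by algebra
  show "trace (C ** A) = - l1 * l2 * l3" unfolding d TW_A_mat3[OF assms(2)] TW_B_mat3[OF assms(2)] mat3_simps by algebra
  show "trace (C ** (A ** A) ** (A ** A)) = l1 * l2 * l3 * D" unfolding d by algebra
  show "trace (C ** C ** (A ** A)) = l1 * l2 * l3 * D" unfolding d by algebra
  show "trace (C ** (A ** A) ** (C ** (A ** A))) = 0" unfolding d by algebra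
  show "trace (C ** (A ** A) ** (C ** (A ** A)) ** (A ** A)) = 0" unfolding d by algebra
qed

section \<open>Consequences of the relations: traces of \<open>S\<close> and its quotient by
  \<open>A ** B\<close>\<close>

lemma loop_braid_relations_consequences:
  assumes "loop_braid_relations A B s S"
  shows "s ** S ** s = S ** S" "s ** S ** S = S ** s" "invertible s" "invertible S"
proof -
  have r: "s ** s = mat 1" "S ** S ** S = mat 1" "s ** S ** s ** S = mat 1"
    using assms by (simp_all add: loop_braid_relations_def)
  have "s ** S ** s = s ** S ** s ** (S ** S ** S)" by (simp add: r)
  also have "\<dots> = S ** S" by (simp add: matrix_mul_assoc r(3))
  finally show sSs: "s ** S ** s = S ** S" .
  have "s ** S ** S = s ** (s ** S ** s)" by (simp add: sSs matrix_mul_assoc)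
  then show "s ** S ** S = S ** s" by (simp add: matrix_mul_assoc r)
  have "S ** (S ** S) = mat 1" using r(2) by (simp add: matrix_mul_assoc)
  then show "invertible s" "invertible S" using r unfolding invertible_def by blast+
qed

lemma loop_braid_traces:
  fixes A B s S :: "'a::field_char_0^3^3"
  assumes rels: "loop_braid_relations A B s S" and "A \<noteq> B"
  shows "trace S = 0" "trace (S ** S) = 0"
proof -
  note c = loop_braid_relations_consequences[OF rels]
  have r: "s ** s = mat 1" "S ** S ** S = mat 1" "s ** S ** s ** S = mat 1" "S ** A = B ** S"
    using rels by (simp_all add: loop_braid_relations_def)
  \<comment> \<open>\<open>det S\<close> is both a square root and a cube root of 1.\<close>
  have "det s * det s = 1" "det S * det S * det S = 1" "det s * det S * det s * det S = 1"
    using r[THEN arg_cong[where f = det]] by (simp_all add: det_mul)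
  then have detS: "det S = 1" by algebra
  \<comment> \<open>\<open>S ** S\<close> is the conjugate of \<open>S\<close> by the involution
    \<open>s\<close>, so the traces agree.\<close>
  have "trace (S ** S) = trace (s ** (S ** s))" by (simp add: c(1) matrix_mul_assoc)
  also have "\<dots> = trace (S ** s ** s)" by (rule trace_mul_sym)
  finally have tr: "trace (S ** S) = trace S" by (simp add: r flip: matrix_mul_assoc)
  text \<open>As \<open>det S = 1\<close> and \<open>S\<^sup>3 = 1\<close>, the theorem of Cayley and Hamilton makes \<open>S\<close> scalar
    unless its trace vanishes; a scalar \<open>S\<close> would give \<open>A = B\<close>.\<close>
  define t where "t = trace S"
  have "S ** S ** S + ((t ^ 2 - t) / 2) *\<^sub>m S = t *\<^sub>m (S ** S) + mat 1"
    using Cayley_Hamilton_3[of S] by (simp add: tr t_def detS)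
  then have "((t ^ 2 - t) / 2) *\<^sub>m S = t *\<^sub>m (S ** S)" by (simp add: r add.commute)
  then have "((t ^ 2 - t) / 2) *\<^sub>m mat 1 = t *\<^sub>m S"
    using invertible_mult_cancel_left[OF c(4), of "((t ^ 2 - t) / 2) *\<^sub>m mat 1" "t *\<^sub>m S"]
    by (simp add: mat_scale_mult_right)
  moreover have "S \<noteq> k *\<^sub>m mat 1" for k
  proof
    assume S: "S = k *\<^sub>m mat 1"
    then have "k *\<^sub>m A = k *\<^sub>m B" using r(4) by (simp add: mat_scale_mult_right mat_scale_mult_left)
    moreover have "k \<noteq> 0" using detS S by (auto simp: mat_1_mat3 mat_scale_mat3 det_mat3)
    ultimately show False using \<open>A \<noteq> B\<close> mat_scale_cancel by blast
  qed
  moreover have "S = (inverse t * ((t ^ 2 - t) / 2)) *\<^sub>m mat 1" if "t \<noteq> 0"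
    "((t ^ 2 - t) / 2) *\<^sub>m mat 1 = t *\<^sub>m S"
    using arg_cong[OF that(2), of "\<lambda>X. inverse t *\<^sub>m X"] that(1) by (simp add: mat_scale_scale)
  ultimately have "t = 0" by blast
  then show "trace S = 0" "trace (S ** S) = 0" by (simp_all add: t_def tr)
qed

text \<open>Conjugation by \<open>A ** B\<close> and by \<open>S\<close> both send \<open>A\<close>
  to \<open>B\<close> and \<open>s\<close> to \<open>s ** S\<close>, so these two matrices differ by
  a factor commuting with \<open>A\<close> and \<open>s\<close>.\<close>

lemma quotient_commutes:
  fixes A B s S E :: "'a::field^'n^'n"
  assumes rels: "loop_braid_relations A B s S" and inv: "invertible A" "invertible B"
    and braid: "A ** B ** A = B ** A ** B" and S: "S = A ** B ** E"
  shows "A ** E = E ** A" "s ** E = E ** s"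
proof -
  note c = loop_braid_relations_consequences[OF rels]
  have r: "S ** A = B ** S" "A ** B ** s = s ** S ** A ** B"
    using rels by (simp_all add: loop_braid_relations_def)
  have C: "invertible (A ** B)" using inv by (rule invertible_mult)
  have "A ** B ** (A ** E) = B ** (A ** B ** E)"
    by (simp add: braid matrix_mul_assoc)
  also have "\<dots> = S ** A" by (simp only: r S[symmetric])
  also have "\<dots> = A ** B ** (E ** A)" by (simp add: S matrix_mul_assoc)
  finally show "A ** E = E ** A" by (rule invertible_mult_cancel_left[OF C])
  have "A ** B ** (s ** E) = s ** S ** (A ** B ** E)" by (simp add: r matrix_mul_assoc)
  also have "\<dots> = S ** s" by (simp add: c flip: S)
  also have "\<dots> = A ** B ** (E ** s)" by (simp add: S matrix_mul_assoc)
  finally show "s ** E = E ** s" by (rule invertible_mult_cancel_left[OF C])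
qed

text \<open>\<open>nonscalar\<close> excludes exactly the case of a scalar \<open>A ** A\<close>.
  Otherwise \<open>A\<close> has a cyclic vector: the third basis vector if
  \<open>l3 \<noteq> - l2\<close>, else the sum of the first and the third.\<close>

lemma TW_commutant:
  fixes l1 l2 l3 :: complex
  defines "A \<equiv> TW_A l1 l2 l3"
  assumes nz: "l1 \<noteq> 0" "l2 \<noteq> 0" and E: "A ** E = E ** A"
    and nonscalar: "\<not> (l3 = - l2 \<and> l1^2 = l2^2)"
  shows "\<exists>a b c. E = a *\<^sub>m mat 1 + b *\<^sub>m A + c *\<^sub>m (A ** A)"
proof -
  obtain q where q: "l1 = q * l2" "q \<noteq> 0" using nz obtain_ratio by blast
  have mv: "mat3 a b c d e f g h i *v vector [x, y, z] =
      vector [a * x + b * y + c * z, d * x + e * y + f * z, g * x + h * y + i * z]"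
    for a b c d e f g h i x y z :: complex
    by (simp add: vec_eq_iff forall_3 matrix_vector_mult_def sum_3)
  have "\<exists>v. det (vector [v, A *v v, A *v (A *v v)]) \<noteq> 0"
  proof (cases "l3 = - l2")
    case False
    have "det (vector [vector [0, 0, 1], A *v vector [0, 0, 1], A *v (A *v vector [0, 0, 1])]) =
        - q * l2^2 * (l2 + l3)"
      unfolding A_def q(1) TW_A_mat3[OF nz(2)] mv det_mat3 by algebra
    also have "\<dots> \<noteq> 0" using False nz q by (simp add: add_eq_0_iff)
    finally show ?thesis by blast
  next
    case True
    have "det (vector [vector [1, 0, 1], A *v vector [1, 0, 1], A *v (A *v vector [1, 0, 1])]) =
        (1 - q^2) * l2^3"
      unfolding A_def q(1) TW_A_mat3[OF nz(2)] mv det_mat3 True by algebra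
    also have "\<dots> \<noteq> 0" using nonscalar True nz(2) by (simp add: q power_mult_distrib)
    finally show ?thesis by blast
  qed
  then show ?thesis using commutant_cyclic[OF E] by blast
qed

lemma TW_A_neq_TW_B: "l2 \<noteq> 0 \<Longrightarrow> TW_A l1 l2 l3 \<noteq> TW_B l1 l2 l3"
  by (simp add: TW_A_def TW_B_def mat3_eq_iff)

section \<open>Extensions in which the product of the involutions is not a multiple of \<open>AB\<close>\<close>

lemma TW_nonscalar_quotient:
  fixes l1 l2 l3 :: complex
  defines "A \<equiv> TW_A l1 l2 l3" and "B \<equiv> TW_B l1 l2 l3"
  assumes nz: "l1 \<noteq> 0" "l2 \<noteq> 0" "l3 \<noteq> 0"
    and rels: "loop_braid_relations A B s S" and S: "\<And>k. S \<noteq> k *\<^sub>m (A ** B)"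
  shows "(l1 + l2) * (l1 + l3) * (l2 + l3) = 0"
    and "s ** (A ** A) = A ** A ** s"
    and "\<not> (l3 = - l2 \<and> l1^2 = l2^2) \<Longrightarrow>
      \<exists>a c. S = a *\<^sub>m (A ** B) + c *\<^sub>m (A ** B ** (A ** A))"
proof -
  note inv = invertible_TW_A[OF nz, folded A_def] invertible_TW_B[OF nz, folded B_def]
  note braid = TW_braid[OF nz, folded A_def B_def]
  have neq: "A \<noteq> B" using TW_A_neq_TW_B nz by (simp add: A_def B_def)
  note tr = loop_braid_traces[OF rels neq]
  note c = loop_braid_relations_consequences[OF rels]
  define C where "C = A ** B"
  define D where "D = (l1 + l2) * (l1 + l3) * (l2 + l3)"
  note trC = TW_traces[OF nz(1,2), of l3, folded A_def B_def D_def, folded C_def]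
  define E where "E = matrix_inv C ** S"
  have SE: "S = C ** E"
    using matrix_inv_mult_right[OF invertible_mult[OF inv]]
    by (simp add: E_def C_def matrix_mul_assoc)
  note comm = quotient_commutes[OF rels inv braid SE[unfolded C_def]]
  have form: "\<exists>a c. E = a *\<^sub>m mat 1 + c *\<^sub>m (A ** A) \<and> c \<noteq> 0" if ns: "\<not> (l3 = - l2 \<and> l1^2 = l2^2)"
  proof -
    obtain a b c where E: "E = a *\<^sub>m mat 1 + b *\<^sub>m A + c *\<^sub>m (A ** A)"
      using TW_commutant[OF nz(1,2) comm(1)[unfolded A_def] ns] unfolding A_def by blast
    \<comment> \<open>Of \<open>C\<close>, \<open>C ** A\<close> and \<open>C ** (A ** A)\<close>
      only the second has nonzero trace, so the trace of \<open>S\<close> isolates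
      \<open>b\<close>.\<close>
    have "trace S = - b * (l1 * l2 * l3)"
      by (simp add: SE E matrix_add_ldistrib mat_scale_mult_right trace_add trace_scale trC)
    then have "b = 0" using tr nz by simp
    then have E': "E = a *\<^sub>m mat 1 + c *\<^sub>m (A ** A)" unfolding E by (simp add: vec_eq_iff)
    moreover have "c \<noteq> 0"
    proof
      assume "c = 0"
      then have "S = a *\<^sub>m C"
        unfolding SE E' by (simp add: matrix_add_ldistrib mat_scale_mult_right) (simp add: vec_eq_iff)
      then show False using S C_def by blast
    qed
    ultimately show ?thesis by blast
  qed
  show "\<exists>a c. S = a *\<^sub>m (A ** B) + c *\<^sub>m (A ** B ** (A ** A))" if ns: "\<not> (l3 = - l2 \<and> l1^2 = l2^2)"
  proof -
    obtain a c where "E = a *\<^sub>m mat 1 + c *\<^sub>m (A ** A)" using form[OF ns] by blast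
    then have "S = a *\<^sub>m (A ** B) + c *\<^sub>m (A ** B ** (A ** A))"
      by (simp add: SE C_def matrix_add_ldistrib mat_scale_mult_right)
    then show ?thesis by blast
  qed
  show sAA: "s ** (A ** A) = A ** A ** s"
  proof (cases "l3 = - l2 \<and> l1^2 = l2^2")
    case True
    obtain q where q: "l1 = q * l2" using nz obtain_ratio by blast
    have "l3 = - l2" and "q^2 = 1" using True nz by (simp_all add: q power_mult_distrib)
    \<comment> \<open>The (1,2) entry of \<open>A ** A\<close>; the other off-diagonal entries
      vanish by \<open>l3 = - l2\<close>.\<close>
    moreover from this(2) have "(q * l2 + l2) * (q * - l2 + l2) = 0" by algebra
    ultimately have "A ** A = l2^2 *\<^sub>m mat 1"
      unfolding A_def q TW_AA_mat3[OF nz(2)] mat3_simps by (auto simp: power_mult_distrib)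
    then show ?thesis by (simp add: mat_scale_mult_left mat_scale_mult_right)
  next
    case False
    then obtain a c where E: "E = a *\<^sub>m mat 1 + c *\<^sub>m (A ** A)" "c \<noteq> 0" using form by blast
    have "c *\<^sub>m (s ** (A ** A)) = c *\<^sub>m (A ** A ** s)"
      using comm(2) unfolding E(1)
      by (simp add: matrix_add_ldistrib matrix_add_rdistrib mat_scale_mult_left mat_scale_mult_right)
    then show ?thesis using mat_scale_cancel[OF E(2)] by blast
  qed
  show "(l1 + l2) * (l1 + l3) * (l2 + l3) = 0"
  proof (rule ccontr)
    assume "(l1 + l2) * (l1 + l3) * (l2 + l3) \<noteq> 0"
    then have D: "D \<noteq> 0" and "l3 \<noteq> - l2" by (auto simp: D_def)
    then obtain a c where E: "E = a *\<^sub>m mat 1 + c *\<^sub>m (A ** A)" "c \<noteq> 0" using form by blast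
    have S': "S = a *\<^sub>m C + c *\<^sub>m (C ** (A ** A))"
      by (simp add: SE E matrix_add_ldistrib mat_scale_mult_right)
    have "trace (C ** (A ** A) ** C) = trace (C ** C ** (A ** A))"
      by (metis trace_mul_sym matrix_mul_assoc)
    \<comment> \<open>The squares of \<open>C\<close> and \<open>C ** (A ** A)\<close> are
      traceless, so only the mixed terms remain, and \<open>c \<noteq> 0\<close> forces
      \<open>a = 0\<close>.\<close>
    then have "trace (S ** S) = 2 * a * c * (l1 * l2 * l3 * D)"
      by (simp add: S' matrix_add_ldistrib matrix_add_rdistrib mat_scale_mult_right
          mat_scale_mult_left trace_add trace_scale trC matrix_mul_assoc[of C C])
    then have "a = 0" using tr E D nz by simp
    then have S': "S = c *\<^sub>m (C ** (A ** A))" unfolding S' by (simp add: vec_eq_iff)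
    have "trace (S ** (A ** A)) = trace (S ** (A ** A) ** (s ** s))"
      using rels by (simp add: loop_braid_relations_def)
    also have "\<dots> = trace (s ** (S ** (A ** A) ** s))"
      by (metis trace_mul_sym matrix_mul_assoc)
    also have "s ** (S ** (A ** A) ** s) = s ** S ** s ** (A ** A)"
      by (simp add: sAA flip: matrix_mul_assoc)
    also have "trace \<dots> = 0"
      unfolding c(1) unfolding S' by (simp add: mat_scale_mult_right mat_scale_mult_left trace_scale trC)
    finally have "c * (l1 * l2 * l3 * D) = 0"
      by (simp add: S' mat_scale_mult_left trace_scale trC)
    then show False using E D nz by simp
  qed
qed

text \<open>With \<open>s ** S\<close> the image of s2, this is the additional relation of
  \<open>SLB3\<close>. Multiplied by \<open>A ** B\<close> on the right it says that
  \<open>s\<close> commutes with \<open>B ** A ** A ** B\<close>.\<close>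

lemma TW_factors_over_SLB3:
  fixes l1 l2 l3 :: complex
  defines "A \<equiv> TW_A l1 l2 l3" and "B \<equiv> TW_B l1 l2 l3"
  assumes nz: "l1 \<noteq> 0" "l2 \<noteq> 0" "l3 \<noteq> 0"
    and rels: "loop_braid_relations A B s S"
    and sAA: "s ** (A ** A) = A ** A ** s"
  shows "B ** A ** (s ** S) = s ** B ** A"
proof -
  define C where "C = A ** B"
  define X where "X = B ** A ** C"
  have inv: "invertible A" "invertible B"
    using nz by (simp_all add: A_def B_def invertible_TW_A invertible_TW_B)
  have r: "C ** s = s ** S ** C"
    using rels by (simp add: loop_braid_relations_def C_def matrix_mul_assoc)
  have braid: "A ** B ** A = B ** A ** B" using TW_braid[OF nz] by (simp add: A_def B_def)
  text \<open>\<open>B A\<^sup>2 B\<close> is a scalar multiple of the inverse of \<open>A\<^sup>2\<close>.\<close>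
  have "A ** A ** X = A ** (A ** B ** A) ** C" by (simp add: X_def matrix_mul_assoc)
  also have "\<dots> = C ** C ** C" unfolding braid by (simp add: C_def matrix_mul_assoc)
  also have "\<dots> = (l1 * l2 * l3)^2 *\<^sub>m mat 1"
    using TW_AB_cube[OF nz(1,2)] by (simp add: C_def A_def B_def)
  finally have AAX: "A ** A ** X = (l1 * l2 * l3)^2 *\<^sub>m mat 1" .
  have "A ** A ** (X ** s) = s ** (A ** A ** X)"
    by (simp add: AAX matrix_mul_assoc mat_scale_mult_left mat_scale_mult_right)
  also have "\<dots> = s ** (A ** A) ** X" by (simp add: matrix_mul_assoc)
  also have "\<dots> = A ** A ** (s ** X)" unfolding sAA by (simp add: matrix_mul_assoc)
  finally have "X ** s = s ** X" by (rule invertible_mult_cancel_left[OF invertible_mult[OF inv(1) inv(1)]])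
  then have "B ** A ** (s ** S) ** C = s ** B ** A ** C"
    by (simp add: X_def r flip: matrix_mul_assoc)
  then have "(B ** A ** (s ** S)) ** (C ** matrix_inv C) = (s ** B ** A) ** (C ** matrix_inv C)"
    by (simp add: matrix_mul_assoc)
  then show ?thesis
    using matrix_inv_mult_right[OF invertible_mult[OF inv]] by (simp add: C_def)
qed

section \<open>Normal form when the last two eigenvalues are opposite\<close>

lemma TW_opposite_normal_form:
  fixes m1 m2 :: complex
  defines "A \<equiv> TW_A m1 m2 (- m2)" and "B \<equiv> TW_B m1 m2 (- m2)"
  assumes nz: "m1 \<noteq> 0" "m2 \<noteq> 0" and ne: "m1 \<noteq> m2" "m1 \<noteq> - m2"
    and rels: "loop_braid_relations A B s S" and S: "\<And>k. S \<noteq> k *\<^sub>m (A ** B)"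
  shows "\<exists>z \<epsilon>. z \<noteq> 0 \<and> \<epsilon> \<in> {1, -1} \<and> S = sym_s1s2_mat z \<and> s = \<epsilon> *\<^sub>m sym_s1_mat z"
proof -
  obtain q where q: "m1 = q * m2" using nz obtain_ratio by blast
  have q1: "q \<noteq> 1" "q \<noteq> - 1" using ne q by auto
  have nz3: "- m2 \<noteq> 0" using nz by simp
  have "m1^2 \<noteq> m2^2" using ne by (simp add: power2_eq_iff)
  then obtain a0 c0 where S0: "S = a0 *\<^sub>m (A ** B) + c0 *\<^sub>m (A ** B ** (A ** A))"
    using TW_nonscalar_quotient(3)[OF nz nz3 rels[unfolded A_def B_def] S[unfolded A_def B_def]]
    unfolding A_def B_def by blast
  have sAA: "s ** (A ** A) = A ** A ** s"
    using TW_nonscalar_quotient(2)[OF nz nz3 rels[unfolded A_def B_def] S[unfolded A_def B_def]]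
    unfolding A_def B_def by blast
  \<comment> \<open>Absorbing the powers of \<open>m2\<close> into the coefficients leaves all
    entries of \<open>S\<close> expressed by \<open>z\<close>, its (1,3) entry, and
    \<open>u\<close>, minus its (3,1) entry.\<close>
  define a1 where "a1 = a0 * m2^2"
  define c1 where "c1 = c0 * m2^4"
  define z where "z = q * (a1 + c1)"
  define u where "u = a1 + c1 * q^2"
  have S1: "S = mat3 0 0 z 0 z z (- u) (u - z) (- z)"
    unfolding S0 A_def B_def q TW_AB_mat3[OF nz(2)] TW_AA_mat3[OF nz(2)] mat3_simps
      z_def u_def a1_def c1_def
    by (intro conjI; algebra)
  have SSS: "S ** S ** S = mat 1" using rels by (simp add: loop_braid_relations_def)
  \<comment> \<open>For matrices of this shape the cube is \<open>u * z^2\<close> times the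
    identity.\<close>
  have uz: "u * z^2 = 1" using SSS unfolding S1 mat3_simps by algebra
  then have "z \<noteq> 0" by auto
  have u: "u = 1 / z^2" using uz \<open>z \<noteq> 0\<close> by (simp add: field_simps)
  have S_eq: "S = sym_s1s2_mat z"
    unfolding S1 sym_s1s2_mat_def mat3_eq_iff u using \<open>z \<noteq> 0\<close> by (simp add: field_simps eval_nat_numeral)
  obtain a b c d e f g h i where s: "s = mat3 a b c d e f g h i" by (rule mat3_cases)
  have AA: "A ** A = m2^2 *\<^sub>m mat3 (q^2) (1 - q^2) 0 0 1 0 0 0 1"
    unfolding A_def q TW_AA_mat3[OF nz(2)] mat3_simps by (intro conjI; algebra)
  have "m2^2 *\<^sub>m (s ** mat3 (q^2) (1 - q^2) 0 0 1 0 0 0 1) =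
      m2^2 *\<^sub>m (mat3 (q^2) (1 - q^2) 0 0 1 0 0 0 1 ** s)"
    using sAA by (simp add: AA mat_scale_mult_left mat_scale_mult_right)
  then have "s ** mat3 (q^2) (1 - q^2) 0 0 1 0 0 0 1 = mat3 (q^2) (1 - q^2) 0 0 1 0 0 0 1 ** s"
    using nz by (simp add: mat_scale_cancel)
  \<comment> \<open>\<open>s\<close> preserves the eigenspaces of \<open>A ** A\<close>: the line of
    the first basis vector and the plane where the first two coordinates agree. Their eigenvalues
    differ because \<open>q^2 \<noteq> 1\<close>.\<close>
  then have "(1 - q^2) * d = 0" "(1 - q^2) * g = 0" "(1 - q^2) * (a + b - e) = 0" "(1 - q^2) * (c - f) = 0"
    unfolding s mat3_simps by algebra+
  moreover have "1 - q^2 \<noteq> 0" using q1 by (simp add: power2_eq_1_iff)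
  ultimately have "d = 0" "g = 0" "a + b - e = 0" "c - f = 0" by simp_all
  then have s1: "d = 0" "g = 0" "b = e - a" "f = c" by (simp_all add: algebra_simps)
  have ss: "s ** s = mat 1" using rels by (simp add: loop_braid_relations_def)
  then have "a * a = 1" unfolding s s1 mat3_simps by simp
  then have a: "a \<in> {1, -1}" by (simp add: square_eq_1_iff)
  have "s ** S = S ** S ** s"
  proof -
    have "s ** S ** s ** s = S ** S ** s"
      by (simp add: loop_braid_relations_consequences[OF rels])
    then show ?thesis by (simp add: ss flip: matrix_mul_assoc)
  qed
  \<comment> \<open>Comparison of the first columns; \<open>u\<close> is nonzero by
    \<open>uz\<close>.\<close>
  then have "u * c = u * (a * z)" "u * i = u * (- a * z)"
    unfolding s s1 S1 mat3_simps by algebra+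
  then have c: "c = a * z" and i: "i = - a * z" using uz by (auto simp only: mult_cancel_left mult_zero_left zero_neq_one)
  have "c * e + c * i = 0" "e * e + c * h = 1"
    using ss unfolding s s1 mat3_simps by (simp_all add: mult.commute)
  moreover have "a * a = 1" by fact
  ultimately have e: "e = a * z" and h: "h * z = a * (1 - z^2)"
    using \<open>z \<noteq> 0\<close> unfolding c i by algebra+
  have "h = a * ((1 - z^2) / z)" using h \<open>z \<noteq> 0\<close> by (simp add: field_simps)
  then have "s = a *\<^sub>m sym_s1_mat z"
    unfolding s s1 c e i sym_s1_mat_def mat3_simps by (simp add: algebra_simps)
  then show ?thesis using S_eq a \<open>z \<noteq> 0\<close> by blast
qed

section \<open>Matrices realizing the normal form\<close>

lemma loop_braid_relations_sign:
  fixes A B s S :: "'a::field^'n^'n"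
  assumes "loop_braid_relations A B s S" "\<epsilon> \<in> {1, -1}"
  shows "loop_braid_relations A B (\<epsilon> *\<^sub>m s) S"
proof -
  have "\<epsilon> * \<epsilon> = 1" using assms by auto
  then show ?thesis using assms(1)
    by (simp add: loop_braid_relations_def mat_scale_mult_left mat_scale_mult_right mat_scale_scale)
qed

lemma sym_matrices_loop_braid_relations:
  fixes m1 m2 :: complex
  assumes nz: "m1 \<noteq> 0" "m2 \<noteq> 0" and "z \<noteq> 0"
  shows "loop_braid_relations (TW_A m1 m2 (- m2)) (TW_B m1 m2 (- m2)) (sym_s1_mat z) (sym_s1s2_mat z)"
proof -
  obtain q where q: "m1 = q * m2" using nz obtain_ratio by blast
  define u where "u = 1 / z"
  have uz: "u * z = 1" using assms by (simp add: u_def)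
  have S: "sym_s1s2_mat z = mat3 0 0 z 0 z z (- (u^2)) (u^2 - z) (- z)"
    using \<open>z \<noteq> 0\<close> unfolding sym_s1s2_mat_def mat3_eq_iff u_def by (simp add: field_simps eval_nat_numeral)
  have s: "sym_s1_mat z = mat3 1 (z - 1) z 0 z z 0 (u - z) (- z)"
    using \<open>z \<noteq> 0\<close> unfolding sym_s1_mat_def mat3_eq_iff u_def by (simp add: field_simps eval_nat_numeral)
  define A where "A = mat3 q (1 - q) 1 0 1 1 0 0 (-1)"
  define B where "B = mat3 (-1) 0 0 (-1) 1 0 1 (q - 1) q"
  have AB: "TW_A m1 m2 (- m2) = m2 *\<^sub>m A" "TW_B m1 m2 (- m2) = m2 *\<^sub>m B"
    unfolding q TW_A_mat3[OF nz(2)] TW_B_mat3[OF nz(2)] A_def B_def mat3_simps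
    by (simp_all add: algebra_simps)
  have sS: "sym_s1_mat z ** sym_s1s2_mat z = mat3 (- u) (u - z) 0 (- u) u 0 u (1 - u) 1"
    unfolding S s mat3_simps by (insert uz, (intro conjI; (algebra | simp add: algebra_simps)))
  have "sym_s1s2_mat z ** A = B ** sym_s1s2_mat z"
    unfolding S A_def B_def mat3_simps by (intro conjI; algebra)
  moreover have "A ** B ** sym_s1_mat z = sym_s1_mat z ** sym_s1s2_mat z ** (A ** B)"
    unfolding sS unfolding s A_def B_def mat3_simps by (insert uz, (intro conjI; (algebra | simp add: algebra_simps)))
  moreover have "sym_s1_mat z ** sym_s1_mat z = mat 1"
    unfolding s mat3_simps by (insert uz, (intro conjI; (algebra | simp add: algebra_simps)))
  moreover have "sym_s1s2_mat z ** sym_s1s2_mat z ** sym_s1s2_mat z = mat 1"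
    unfolding S mat3_simps by (insert uz, (intro conjI; (algebra | simp add: algebra_simps)))
  moreover have "sym_s1_mat z ** sym_s1s2_mat z ** (sym_s1_mat z ** sym_s1s2_mat z) = mat 1"
    unfolding sS mat3_simps by (insert uz, (intro conjI; (algebra | simp add: algebra_simps)))
  ultimately show ?thesis
    unfolding loop_braid_relations_def AB
    by (simp add: mat_scale_mult_left mat_scale_mult_right matrix_mul_assoc)
qed

section \<open>Reducible cases and reordering of the eigenvalues\<close>

lemma TW_opposite_reducible:
  fixes m1 m2 :: complex
  assumes "m2 \<noteq> 0" "m1 = m2 \<or> m1 = - m2"
  shows "\<exists>(K :: complex^3^3) k. K \<noteq> 0 \<and> \<not> invertible K \<and> k \<noteq> 0 \<and>
    TW_A m1 m2 (- m2) ** K = k *\<^sub>m K \<and> TW_B m1 m2 (- m2) ** K = k *\<^sub>m K"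
  using assms(2)
proof
  assume "m1 = m2"
  \<comment> \<open>In both cases the first column of \<open>K\<close> is a common eigenvector for
    \<open>k\<close>; as a singular matrix it can later be used as an intertwiner.\<close>
  then show ?thesis using assms(1)
    by - (rule exI[of _ "mat3 0 0 0 1 0 0 0 0 0"], rule exI[of _ m2],
      auto simp: TW_A_def TW_B_def mat3_simps zero_mat3 det_mat3 invertible_det_nz)
next
  assume "m1 = - m2"
  then show ?thesis using assms(1)
    by - (rule exI[of _ "mat3 2 0 0 1 0 0 (-2) 0 0"], rule exI[of _ "- m2"],
      auto simp: TW_A_def TW_B_def mat3_simps zero_mat3 det_mat3 invertible_det_nz)
qed

text \<open>In the nontrivial cases the first column of \<open>N\<close> is an eigenvector \<open>v\<close> of \<open>A\<close> for \<open>m1\<close>; the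
  first columns of the target matrices then force the third column to be \<open>- C v / m2\<^sup>2\<close>
  with \<open>C = A B\<close>, and determine the second one.\<close>

lemma TW_intertwiner_opposite:
  fixes l1 l2 l3 :: complex
  assumes nz: "l1 \<noteq> 0" "l2 \<noteq> 0" "l3 \<noteq> 0" and prod: "(l1 + l2) * (l1 + l3) * (l2 + l3) = 0"
  shows "\<exists>m1 m2 (N :: complex^3^3). {#m1, m2, - m2#} = {#l1, l2, l3#} \<and> m1 \<noteq> 0 \<and> m2 \<noteq> 0 \<and> N \<noteq> 0 \<and>
    TW_A l1 l2 l3 ** N = N ** TW_A m1 m2 (- m2) \<and> TW_B l1 l2 l3 ** N = N ** TW_B m1 m2 (- m2)"
proof -
  consider "l3 = - l2" | "l1 = - l2" | "l3 = - l1"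
    using prod by (auto simp: add_eq_0_iff)
  then show ?thesis
  proof cases
    case 1
    then show ?thesis using nz
      by - (rule exI[of _ l1], rule exI[of _ l2], rule exI[of _ "mat 1"], simp, simp add: mat3_simps zero_mat3)
  next
    case 2
    then show ?thesis using nz
      by - (rule exI[of _ l3], rule exI[of _ l2],
          rule exI[of _ "mat3 0 (l3 - l2) (l3 - l2) l2 (- 3 * l2) (- l2) (l3 - l2) (l2 - l3) 0"],
        auto simp: TW_A_def TW_B_def mat3_simps zero_mat3 algebra_simps)
  next
    case 3
    then show ?thesis using nz
      by - (rule exI[of _ l2], rule exI[of _ l1],
          rule exI[of _ "mat3 (l1 + l2) 0 0 l2 (- l2) (- l2) 0 0 (l1 + l2)"],
        auto simp: TW_A_def TW_B_def mat3_simps zero_mat3 field_simps)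
  qed
qed

section \<open>Extensions in which the product of the involutions is a multiple of \<open>AB\<close>\<close>

lemma cube_root_of_unity:
  assumes "(\<omega> :: complex)^3 = 1" "\<omega> \<noteq> 1"
  shows "\<omega>^2 + \<omega> + 1 = 0" "\<omega> \<noteq> 0" "\<omega>^2 \<noteq> 1" "\<omega>^2 \<noteq> \<omega>"
proof -
  have "(\<omega> - 1) * (\<omega>^2 + \<omega> + 1) = 0" using assms(1) by algebra
  then show s: "\<omega>^2 + \<omega> + 1 = 0" using assms(2) by simp
  show "\<omega> \<noteq> 0" using assms(1) by auto
  then show "\<omega>^2 \<noteq> \<omega>" using assms(2) by (simp add: power2_eq_square)
  show "\<omega>^2 \<noteq> 1"
  proof
    assume "\<omega>^2 = 1"
    then have "\<omega> = 1" using assms(1) by algebra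
    then show False using assms(2) by simp
  qed
qed

lemma TW_AB_diagonalizable:
  fixes l1 l2 l3 \<omega> \<gamma> :: complex
  defines "A \<equiv> TW_A l1 l2 l3" and "B \<equiv> TW_B l1 l2 l3"
  assumes nz: "l1 \<noteq> 0" "l2 \<noteq> 0" "l3 \<noteq> 0" and \<omega>: "\<omega>^3 = 1" "\<omega> \<noteq> 1" and \<gamma>: "\<gamma>^3 = l1 * l2 * l3"
  shows "\<exists>M. invertible M \<and> (1 / \<gamma>^2) *\<^sub>m (matrix_inv M ** A ** B ** M) = diag3 1 \<omega> (\<omega>^2)"
proof -
  note w = cube_root_of_unity[OF \<omega>]
  have g: "\<gamma> \<noteq> 0" using \<gamma> nz by auto
  obtain q where q: "l1 = q * l2" "q \<noteq> 0" using nz obtain_ratio by blast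
  define a b c where "a = \<gamma>^2" and "b = \<gamma>^2 * \<omega>" and "c = \<gamma>^2 * \<omega>^2"
  define p r where "p = q * l2 * l3" and "r = q * l2^2"
  \<comment> \<open>\<open>a\<close>, \<open>b\<close>, \<open>c\<close> are the cube roots of
    \<open>(l1 * l2 * l3)^2\<close>, the scalar by which the cube of \<open>A ** B\<close>
    acts.\<close>
  have "(q * l2 * l2 * l3)^2 = (\<gamma>^3)^2" by (simp add: \<gamma> q)
  then have cubes: "a^3 = (q * l2^2 * l3)^2" "b^3 = (q * l2^2 * l3)^2" "c^3 = (q * l2^2 * l3)^2"
    using \<omega>(1) unfolding a_def b_def c_def by algebra+
  text \<open>The columns of \<open>M\<close> are eigenvectors of \<open>AB\<close> for the eigenvalues \<open>a\<close>, \<open>b\<close>, \<open>c\<close>.\<close>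
  define M where "M = mat3 ((a + p) * r) ((b + p) * r) ((c + p) * r) (a * r) (b * r) (c * r)
      (a * (a + p)) (b * (b + p)) (c * (c + p))"
  have AB: "A ** B = mat3 0 0 (q * l2^2) 0 (- q * l2 * l3) (q * l2^2)
      (l2 * l3) (- l3 * (q * l3 + l2)) (q * l2 * l3)"
    unfolding A_def B_def q(1) by (rule TW_AB_mat3[OF nz(2)])
  have "A ** B ** M = M ** mat3 a 0 0 0 b 0 0 0 c"
    unfolding AB M_def mat3_simps p_def r_def
    by (insert cubes, (intro conjI; (algebra | simp add: algebra_simps)))
  also have "mat3 a 0 0 0 b 0 0 0 c = \<gamma>^2 *\<^sub>m diag3 1 \<omega> (\<omega>^2)"
    by (simp add: diag3_def mat3_simps a_def b_def c_def)
  finally have M: "A ** B ** M = \<gamma>^2 *\<^sub>m (M ** diag3 1 \<omega> (\<omega>^2))"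
    by (simp add: mat_scale_mult_right)
  \<comment> \<open>The rows of \<open>M\<close> are polynomials of degree at most two in the
    eigenvalue, so this is a multiple of the Vandermonde determinant of \<open>a\<close>,
    \<open>b\<close>, \<open>c\<close>.\<close>
  have "det M = p * r^2 * ((b - a) * (c - a) * (c - b))"
    unfolding M_def det_mat3 by algebra
  moreover have "a \<noteq> b" "a \<noteq> c" "b \<noteq> c"
    using g w \<omega>(2) by (simp_all add: a_def b_def c_def)
  moreover have "p \<noteq> 0" "r \<noteq> 0" using nz q by (simp_all add: p_def r_def)
  ultimately have "det M \<noteq> 0" by simp
  then have inv: "invertible M" by (simp add: invertible_det_nz)
  have "matrix_inv M ** A ** B ** M = matrix_inv M ** (A ** B ** M)"
    by (simp add: matrix_mul_assoc)
  also have "\<dots> = \<gamma>^2 *\<^sub>m diag3 1 \<omega> (\<omega>^2)"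
    by (simp add: M mat_scale_mult_right matrix_mul_assoc matrix_inv_mult_left[OF inv])
  finally have "(1 / \<gamma>^2) *\<^sub>m (matrix_inv M ** A ** B ** M) = diag3 1 \<omega> (\<omega>^2)"
    using g by (simp add: mat_scale_scale)
  then show ?thesis using inv by blast
qed

lemma involution_inverting_diag3:
  fixes s :: "complex^3^3"
  assumes \<omega>: "\<omega>^3 = 1" "\<omega> \<noteq> 1"
    and ss: "s ** s = mat 1"
    and sDs: "s ** diag3 1 \<omega> (\<omega>^2) ** s = diag3 1 \<omega> (\<omega>^2) ** diag3 1 \<omega> (\<omega>^2)"
  shows "\<exists>\<epsilon>\<in>{1, -1}. \<exists>\<alpha>. \<alpha> \<noteq> 0 \<and> s = S1_mat \<epsilon> \<alpha>"
proof -
  note w = cube_root_of_unity[OF \<omega>]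
  let ?D = "diag3 1 \<omega> (\<omega>^2)"
  obtain a b c d e f g h i where s: "s = mat3 a b c d e f g h i" by (rule mat3_cases)
  have "s ** ?D = s ** ?D ** (s ** s)" by (simp add: ss)
  also have "\<dots> = ?D ** ?D ** s" unfolding sDs[symmetric] by (simp add: matrix_mul_assoc)
  finally have E: "s ** ?D = ?D ** ?D ** s" .
  have w4: "\<omega>^2 * \<omega>^2 = \<omega>" "\<omega>^4 = \<omega>" using \<omega>(1) by algebra+
  \<comment> \<open>An entry of \<open>s\<close> survives only where the eigenvalue of its column is
    the square of that of its row: at (1,1), (2,3) and (3,2).\<close>
  have "b * \<omega> = b" "c * \<omega>^2 = c" "d = \<omega>^2 * d" "e * \<omega> = \<omega>^2 * e" "g = \<omega> * g" "i * \<omega>^2 = \<omega> * i"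
    using E unfolding s diag3_def mat3_simps by (simp_all add: w4 power2_eq_square[symmetric])
  then have z: "b = 0" "c = 0" "d = 0" "e = 0" "g = 0" "i = 0"
    using w \<omega>(2) by (auto simp: mult.commute)
  have "a * a = 1" "f * h = 1" using ss unfolding s z mat3_simps by simp_all
  then have "a \<in> {1, -1}" and f: "f \<noteq> 0" by (auto simp: square_eq_1_iff)
  moreover have "h = 1 / f" using \<open>f * h = 1\<close> f by (simp add: eq_divide_eq mult.commute)
  ultimately show ?thesis unfolding s z S1_mat_def by blast
qed

lemma S1_mat_inverts_diag3:
  assumes "(\<omega> :: complex)^3 = 1"
  shows "S1_mat 1 1 ** S1_mat 1 1 = mat 1"
    and "S1_mat 1 1 ** diag3 1 \<omega> (\<omega>^2) ** S1_mat 1 1 = diag3 1 \<omega> (\<omega>^2) ** diag3 1 \<omega> (\<omega>^2)"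
proof -
  show "S1_mat 1 1 ** S1_mat 1 1 = mat 1" by (simp add: S1_mat_def mat3_simps)
  have "\<omega>^2 * \<omega>^2 = \<omega>" using assms by algebra
  then show "S1_mat 1 1 ** diag3 1 \<omega> (\<omega>^2) ** S1_mat 1 1 = diag3 1 \<omega> (\<omega>^2) ** diag3 1 \<omega> (\<omega>^2)"
    by (simp add: S1_mat_def diag3_def mat3_simps power2_eq_square)
qed

text \<open>For \<open>S\<close> a multiple of \<open>C\<close>, the relation
  \<open>S ** A = B ** S\<close> is the braid relation, and \<open>k\<close> is normalized to give
  \<open>S\<close> order three; the rest expresses that \<open>s\<close> inverts
  \<open>S\<close>.\<close>

lemma scalar_quotient_relations:
  fixes l1 l2 l3 k :: complex
  defines "C \<equiv> TW_A l1 l2 l3 ** TW_B l1 l2 l3"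
  assumes nz: "l1 \<noteq> 0" "l2 \<noteq> 0" "l3 \<noteq> 0" and k: "k^3 * (l1 * l2 * l3)^2 = 1"
    and ss: "s ** s = mat 1" and sCs: "s ** (k *\<^sub>m C) ** s = (k *\<^sub>m C) ** (k *\<^sub>m C)"
  shows "loop_braid_relations (TW_A l1 l2 l3) (TW_B l1 l2 l3) s (k *\<^sub>m C)"
proof -
  define S where "S = k *\<^sub>m C"
  have "k \<noteq> 0" using k by auto
  have "S ** S ** S = (k * k * k) *\<^sub>m (C ** C ** C)"
    by (simp add: S_def mat_scale_mult_left mat_scale_mult_right mat_scale_scale mult_ac)
  also have "\<dots> = mat 1"
    using k by (simp add: C_def TW_AB_cube[OF nz(1,2)] mat_scale_scale power3_eq_cube)
  finally have SSS: "S ** S ** S = mat 1" .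
  have sSs: "s ** S ** s = S ** S" using sCs by (simp add: S_def)
  have "S ** s = s ** s ** S ** s" by (simp add: ss)
  also have "\<dots> = s ** (s ** S ** s)" by (simp add: matrix_mul_assoc)
  finally have "k *\<^sub>m (C ** s) = k *\<^sub>m (s ** S ** C)"
    by (simp add: sSs) (simp add: S_def mat_scale_mult_left mat_scale_mult_right matrix_mul_assoc)
  then have "C ** s = s ** S ** C" using \<open>k \<noteq> 0\<close> by (simp add: mat_scale_cancel)
  moreover have "S ** TW_A l1 l2 l3 = TW_B l1 l2 l3 ** S"
    by (simp add: S_def C_def mat_scale_mult_left mat_scale_mult_right matrix_mul_assoc TW_braid[OF nz])
  ultimately show ?thesis
    unfolding loop_braid_relations_def S_def[symmetric] using ss SSS sSs
    by (simp add: C_def matrix_mul_assoc)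
qed

lemma TW_exists_loop_braid_relations:
  fixes l1 l2 l3 \<omega> :: complex
  assumes nz: "l1 \<noteq> 0" "l2 \<noteq> 0" "l3 \<noteq> 0" and \<omega>: "\<omega>^3 = 1" "\<omega> \<noteq> 1"
  shows "\<exists>s S. loop_braid_relations (TW_A l1 l2 l3) (TW_B l1 l2 l3) s S"
proof -
  define C where "C = TW_A l1 l2 l3 ** TW_B l1 l2 l3"
  define P where "P = l1 * l2 * l3"
  define \<gamma> where "\<gamma> = exp (Ln P / 3)"
  have "P \<noteq> 0" using nz by (simp add: P_def)
  then have \<gamma>: "\<gamma>^3 = P" by (simp add: \<gamma>_def flip: exp_of_nat_mult)
  then have g: "\<gamma> \<noteq> 0" using \<open>P \<noteq> 0\<close> by auto
  define k where "k = 1 / \<gamma>^2"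
  define D where "D = diag3 1 \<omega> (\<omega>^2)"
  obtain M where M: "invertible M" "k *\<^sub>m (matrix_inv M ** C ** M) = D"
    using TW_AB_diagonalizable[OF nz \<omega>] \<gamma> by (auto simp: matrix_mul_assoc C_def P_def k_def D_def)
  note MM = matrix_inv_mult_right[OF M(1)] matrix_inv_mult_left[OF M(1)]
  have conj: "M ** X ** matrix_inv M ** (M ** Y ** matrix_inv M) = M ** (X ** Y) ** matrix_inv M" for X Y
  proof -
    have "M ** X ** matrix_inv M ** (M ** Y ** matrix_inv M) =
        M ** X ** (matrix_inv M ** M) ** Y ** matrix_inv M" by (simp add: matrix_mul_assoc)
    then show ?thesis by (simp add: MM matrix_mul_assoc)
  qed
  have kC: "k *\<^sub>m C = M ** D ** matrix_inv M"
  proof -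
    have "M ** D ** matrix_inv M = k *\<^sub>m ((M ** matrix_inv M) ** C ** (M ** matrix_inv M))"
      unfolding M(2)[symmetric] by (simp add: mat_scale_mult_left mat_scale_mult_right matrix_mul_assoc)
    then show ?thesis by (simp add: MM)
  qed
  have "P^2 = \<gamma>^6" by (simp flip: \<gamma> power_mult)
  then have "k^3 * P^2 = 1" using g by (simp add: k_def power_divide flip: power_mult)
  \<comment> \<open>The involution is chosen in an eigenbasis of \<open>C\<close> and transported
    back by \<open>M\<close>.\<close>
  moreover define s where "s = M ** S1_mat 1 1 ** matrix_inv M"
  have "s ** s = mat 1" unfolding s_def conj by (simp add: S1_mat_inverts_diag3[OF \<omega>(1)] MM)
  moreover have "s ** (k *\<^sub>m C) ** s = (k *\<^sub>m C) ** (k *\<^sub>m C)"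
    unfolding s_def kC conj D_def S1_mat_inverts_diag3[OF \<omega>(1)] ..
  ultimately show ?thesis
    using scalar_quotient_relations[OF nz] unfolding C_def P_def by blast
qed

lemma scalar_quotient_normal_form:
  fixes l1 l2 l3 \<omega> k :: complex
  defines "A \<equiv> TW_A l1 l2 l3" and "B \<equiv> TW_B l1 l2 l3"
  assumes nz: "l1 \<noteq> 0" "l2 \<noteq> 0" "l3 \<noteq> 0" and \<omega>: "\<omega>^3 = 1" "\<omega> \<noteq> 1"
    and rels: "loop_braid_relations A B s S" and S: "S = k *\<^sub>m (A ** B)"
  shows "\<exists>\<gamma>. \<gamma>^3 = l1 * l2 * l3 \<and> S = (1 / \<gamma>^2) *\<^sub>m (A ** B) \<and>
    (\<exists>M. invertible M \<and> (1 / \<gamma>^2) *\<^sub>m (matrix_inv M ** A ** B ** M) = diag3 1 \<omega> (\<omega>^2)) \<and>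
    (\<forall>M. invertible M \<and> (1 / \<gamma>^2) *\<^sub>m (matrix_inv M ** A ** B ** M) = diag3 1 \<omega> (\<omega>^2) \<longrightarrow>
      (\<exists>\<epsilon>\<in>{1, -1}. \<exists>\<alpha>. \<alpha> \<noteq> 0 \<and> s = M ** S1_mat \<epsilon> \<alpha> ** matrix_inv M))"
proof -
  define P where "P = l1 * l2 * l3"
  have "P \<noteq> 0" using nz by (simp add: P_def)
  have "mat 1 = S ** S ** S" using rels by (simp add: loop_braid_relations_def)
  also have "\<dots> = (k * k * k) *\<^sub>m (A ** B ** (A ** B) ** (A ** B))"
    by (simp add: S mat_scale_mult_left mat_scale_mult_right mat_scale_scale mult_ac)
  also have "\<dots> = (k^3 * P^2) *\<^sub>m mat 1"
    by (simp add: A_def B_def P_def TW_AB_cube[OF nz(1,2)] mat_scale_scale power3_eq_cube)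
  finally have kP: "k^3 * P^2 = 1" unfolding mat3_simps by simp
  \<comment> \<open>This cube root of \<open>P\<close> is forced: \<open>k = 1 / \<gamma>^2\<close>
    and \<open>\<gamma>^3 = P\<close> give \<open>\<gamma> = P * k\<close>.\<close>
  define \<gamma> where "\<gamma> = P * k"
  have "k \<noteq> 0" using kP by auto
  have \<gamma>: "\<gamma>^3 = l1 * l2 * l3"
    using kP unfolding \<gamma>_def P_def[symmetric] by algebra
  have "k * \<gamma>^2 = 1" using kP unfolding \<gamma>_def by algebra
  then have k: "k = 1 / \<gamma>^2" by (metis nonzero_eq_divide_eq mult_zero_right zero_neq_one)
  have "\<exists>\<epsilon>\<in>{1, -1}. \<exists>\<alpha>. \<alpha> \<noteq> 0 \<and> s = M ** S1_mat \<epsilon> \<alpha> ** matrix_inv M"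
    if M: "invertible M" "(1 / \<gamma>^2) *\<^sub>m (matrix_inv M ** A ** B ** M) = diag3 1 \<omega> (\<omega>^2)" for M
  proof -
    note MM = matrix_inv_mult_right[OF M(1)] matrix_inv_mult_left[OF M(1)]
    have conj: "matrix_inv M ** X ** M ** (matrix_inv M ** Y ** M) = matrix_inv M ** (X ** Y) ** M" for X Y
    proof -
      have "matrix_inv M ** X ** M ** (matrix_inv M ** Y ** M) =
          matrix_inv M ** X ** (M ** matrix_inv M) ** Y ** M" by (simp add: matrix_mul_assoc)
      then show ?thesis by (simp add: MM matrix_mul_assoc)
    qed
    have D: "diag3 1 \<omega> (\<omega>^2) = matrix_inv M ** S ** M"
      using M(2) by (simp add: S k mat_scale_mult_left mat_scale_mult_right matrix_mul_assoc)
    define s' where "s' = matrix_inv M ** s ** M"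
    have "s' ** s' = mat 1"
      unfolding s'_def conj using rels by (simp add: loop_braid_relations_def MM)
    moreover have "s' ** diag3 1 \<omega> (\<omega>^2) ** s' = diag3 1 \<omega> (\<omega>^2) ** diag3 1 \<omega> (\<omega>^2)"
      unfolding s'_def D conj loop_braid_relations_consequences(1)[OF rels] ..
    ultimately have "\<exists>\<epsilon>\<in>{1, -1}. \<exists>\<alpha>. \<alpha> \<noteq> 0 \<and> s' = S1_mat \<epsilon> \<alpha>"
      by (rule involution_inverting_diag3[OF \<omega>])
    moreover have "s = M ** s' ** matrix_inv M"
    proof -
      have "M ** s' ** matrix_inv M = (M ** matrix_inv M) ** s ** (M ** matrix_inv M)"
        by (simp add: s'_def matrix_mul_assoc)
      then show ?thesis by (simp add: MM)
    qed
    ultimately show ?thesis by blast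
  qed
  then show ?thesis
    using \<gamma> S k TW_AB_diagonalizable[OF nz \<omega> \<gamma>] unfolding A_def B_def by blast
qed

section \<open>The classification of extensions\<close>

text \<open>Irreducibility enters twice: it makes the intertwiner \<open>N\<close> invertible, and
  it excludes \<open>m1 = m2\<close> and \<open>m1 = - m2\<close>, where the target matrices have a
  common eigenvector.\<close>

lemma irreducible_nonscalar_quotient:
  fixes l1 l2 l3 :: complex
  assumes nz: "l1 \<noteq> 0" "l2 \<noteq> 0" "l3 \<noteq> 0" and rep: "is_TW_rep l1 l2 l3 \<rho>"
    and ext: "extends_to_LB3 \<rho> \<tau>" and irr: "irreducible_rep B3 \<rho>"
    and prod: "(l1 + l2) * (l1 + l3) * (l2 + l3) = 0"
    and S: "\<And>k. \<tau> (lb3_gen Ls1 \<otimes>\<^bsub>LB3\<^esub> lb3_gen Ls2) \<noteq> k *\<^sub>m (TW_A l1 l2 l3 ** TW_B l1 l2 l3)"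
  shows "\<exists>m1 m2 m3 N. {#m1, m2, m3#} = {#l1, l2, l3#} \<and> invertible N \<and>
    is_TW_rep m1 m2 m3 (conj_rep N \<rho>) \<and>
    (\<exists>z \<epsilon>. z \<noteq> 0 \<and> \<epsilon> \<in> {1, -1} \<and>
      conj_rep N \<tau> (lb3_gen Ls1 \<otimes>\<^bsub>LB3\<^esub> lb3_gen Ls2) = sym_s1s2_mat z \<and>
      conj_rep N \<tau> (lb3_gen Ls1) = \<epsilon> *\<^sub>m sym_s1_mat z) \<and>
    (\<forall>z \<epsilon>. z \<noteq> 0 \<and> \<epsilon> \<in> {1, -1} \<longrightarrow>
      (\<exists>\<tau>'. extends_to_LB3 (conj_rep N \<rho>) \<tau>' \<and>
        \<tau>' (lb3_gen Ls1 \<otimes>\<^bsub>LB3\<^esub> lb3_gen Ls2) = sym_s1s2_mat z \<and>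
        \<tau>' (lb3_gen Ls1) = \<epsilon> *\<^sub>m sym_s1_mat z))"
proof -
  let ?S = "lb3_gen Ls1 \<otimes>\<^bsub>LB3\<^esub> lb3_gen Ls2"
  let ?A = "TW_A l1 l2 l3" and ?B = "TW_B l1 l2 l3"
  have \<rho>: "\<rho> \<in> hom B3 GL" "\<rho> (b3_gen B\<sigma>1) = ?A" "\<rho> (b3_gen B\<sigma>2) = ?B"
    using rep by (simp_all add: is_TW_rep_def)
  obtain m1 m2 N where perm: "{#m1, m2, - m2#} = {#l1, l2, l3#}" and m: "m1 \<noteq> 0" "m2 \<noteq> 0"
    and "N \<noteq> 0" and AN: "?A ** N = N ** TW_A m1 m2 (- m2)" and BN: "?B ** N = N ** TW_B m1 m2 (- m2)"
    using TW_intertwiner_opposite[OF nz prod] by blast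
  have m3: "- m2 \<noteq> 0" using m by simp
  let ?A' = "TW_A m1 m2 (- m2)" and ?B' = "TW_B m1 m2 (- m2)"
  have inv: "invertible N"
    using invertible_if_intertwines_irreducible[OF irr \<rho>(1)] AN BN \<rho> \<open>N \<noteq> 0\<close>
      invertible_TW_A[OF m m3] invertible_TW_B[OF m m3] by metis
  have ne: "m1 \<noteq> m2 \<and> m1 \<noteq> - m2"
  proof (rule ccontr)
    assume "\<not> ?thesis"
    then obtain K :: "complex^3^3" and k where K: "K \<noteq> 0" "\<not> invertible K" "k \<noteq> 0"
      "?A' ** K = k *\<^sub>m K" "?B' ** K = k *\<^sub>m K"
      using TW_opposite_reducible[OF m(2)] by blast
    \<comment> \<open>\<open>N ** K\<close> intertwines with scalar matrices, so irreducibility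
      would make it invertible although \<open>K\<close> is singular.\<close>
    have "?A ** (N ** K) = N ** K ** (k *\<^sub>m mat 1)" "?B ** (N ** K) = N ** K ** (k *\<^sub>m mat 1)"
    proof -
      have "?A ** (N ** K) = N ** (?A' ** K)" "?B ** (N ** K) = N ** (?B' ** K)"
        by (simp_all add: AN BN matrix_mul_assoc)
      then show "?A ** (N ** K) = N ** K ** (k *\<^sub>m mat 1)" "?B ** (N ** K) = N ** K ** (k *\<^sub>m mat 1)"
        by (simp_all add: K mat_scale_mult_right)
    qed
    moreover have "invertible (k *\<^sub>m mat 1 :: complex^3^3)"
      using K by (simp add: invertible_det_nz mat3_simps det_mat3)
    moreover have "N ** K \<noteq> 0"
      using invertible_mult_cancel_left[OF inv, of K 0] K(1) by auto
    ultimately have "invertible (N ** K)"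
      using invertible_if_intertwines_irreducible[OF irr \<rho>(1)] \<rho> by metis
    then show False using K(2) by (simp add: invertible_det_nz det_mul)
  qed
  have rep': "is_TW_rep m1 m2 (- m2) (conj_rep N \<rho>)"
    using conj_rep_hom[OF \<rho>(1) inv] conj_rep_eq_if_intertwines[OF inv, of \<rho>] \<rho> AN BN
    by (simp add: is_TW_rep_def)
  have ext': "extends_to_LB3 (conj_rep N \<rho>) (conj_rep N \<tau>)"
    by (rule extends_conj_rep[OF ext inv])
  have rels: "loop_braid_relations ?A' ?B' (conj_rep N \<tau> (lb3_gen Ls1)) (conj_rep N \<tau> ?S)"
    using loop_braid_relations_if_extends(1)[OF ext'] rep' by (simp add: is_TW_rep_def)
  have S': "conj_rep N \<tau> ?S \<noteq> k *\<^sub>m (?A' ** ?B')" for k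
  proof
    assume "conj_rep N \<tau> ?S = k *\<^sub>m (?A' ** ?B')"
    then have "N ** conj_rep N \<tau> ?S ** matrix_inv N = k *\<^sub>m (N ** ?A' ** ?B' ** matrix_inv N)"
      by (simp add: mat_scale_mult_left mat_scale_mult_right matrix_mul_assoc)
    also have "N ** ?A' ** ?B' ** matrix_inv N = ?A ** ?B ** (N ** matrix_inv N)"
    proof -
      have "N ** ?A' ** ?B' = ?A ** (N ** ?B')" by (simp add: AN[symmetric] matrix_mul_assoc)
      also have "\<dots> = ?A ** ?B ** N" by (simp add: BN[symmetric] matrix_mul_assoc)
      finally show ?thesis by (simp add: matrix_mul_assoc)
    qed
    also have "N ** conj_rep N \<tau> ?S ** matrix_inv N = (N ** matrix_inv N) ** \<tau> ?S ** (N ** matrix_inv N)"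
      by (simp add: conj_rep_def matrix_mul_assoc)
    finally show False using S by (simp add: matrix_inv_mult_right[OF inv])
  qed
  have "\<exists>z \<epsilon>. z \<noteq> 0 \<and> \<epsilon> \<in> {1, -1} \<and>
      conj_rep N \<tau> ?S = sym_s1s2_mat z \<and> conj_rep N \<tau> (lb3_gen Ls1) = \<epsilon> *\<^sub>m sym_s1_mat z"
    using TW_opposite_normal_form[OF m _ _ rels S'] ne by blast
  moreover have "\<exists>\<tau>'. extends_to_LB3 (conj_rep N \<rho>) \<tau>' \<and> \<tau>' ?S = sym_s1s2_mat z \<and>
      \<tau>' (lb3_gen Ls1) = \<epsilon> *\<^sub>m sym_s1_mat z" if "z \<noteq> 0" "\<epsilon> \<in> {1, -1}" for z \<epsilon>
  proof -
    have "conj_rep N \<rho> (b3_gen B\<sigma>1) = ?A'" "conj_rep N \<rho> (b3_gen B\<sigma>2) = ?B'"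
      using rep' by (simp_all add: is_TW_rep_def)
    then show ?thesis
      using extends_if_loop_braid_relations[of "conj_rep N \<rho>"]
        loop_braid_relations_sign[OF sym_matrices_loop_braid_relations[OF m that(1)] that(2)]
        invertible_TW_A[OF m m3] invertible_TW_B[OF m m3] TW_braid[OF m m3] by simp
  qed
  ultimately show ?thesis using perm inv rep' by blast
qed

text \<open>Permuting the eigenvalues is realized by the change of basis \<open>N\<close>, obtained
  from irreducibility; hence that hypothesis in the matrix normal form. The last clause, with
  \<open>\<tau>'\<close> for all \<open>z\<close> and \<open>\<epsilon>\<close>, expresses that
  \<open>z\<close> is free. The existence of \<open>M\<close> keeps the claim about every
  \<open>M\<close> from being vacuous.\<close>

theorem proposition4p4:
  fixes l1 l2 l3 \<omega> :: complex
    and \<rho> :: "braid_gen word set \<Rightarrow> complex^3^3"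
  assumes "l1 \<noteq> 0" and "l2 \<noteq> 0" and "l3 \<noteq> 0"
    and "\<omega>^3 = 1" and "\<omega> \<noteq> 1"
    and "is_TW_rep l1 l2 l3 \<rho>"
  shows "(\<exists>\<tau>. extends_to_LB3 \<rho> \<tau>) \<and>
    (\<forall>\<tau>. extends_to_LB3 \<rho> \<tau> \<longrightarrow>
      (\<exists>\<gamma>. \<gamma>^3 = l1 * l2 * l3 \<and>
        \<tau> (lb3_gen Ls1 \<otimes>\<^bsub>LB3\<^esub> lb3_gen Ls2) = (1 / \<gamma>^2) *\<^sub>m (TW_A l1 l2 l3 ** TW_B l1 l2 l3) \<and>
        (\<exists>M. invertible M \<and>
          (1 / \<gamma>^2) *\<^sub>m (matrix_inv M ** TW_A l1 l2 l3 ** TW_B l1 l2 l3 ** M) = diag3 1 \<omega> (\<omega>^2)) \<and>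
        (\<forall>M. invertible M \<and>
          (1 / \<gamma>^2) *\<^sub>m (matrix_inv M ** TW_A l1 l2 l3 ** TW_B l1 l2 l3 ** M) = diag3 1 \<omega> (\<omega>^2) \<longrightarrow>
          (\<exists>\<epsilon>\<in>{1, -1}. \<exists>\<alpha>. \<alpha> \<noteq> 0 \<and>
            \<tau> (lb3_gen Ls1) = M ** S1_mat \<epsilon> \<alpha> ** matrix_inv M)))
      \<or>
      ((\<forall>k. \<tau> (lb3_gen Ls1 \<otimes>\<^bsub>LB3\<^esub> lb3_gen Ls2) \<noteq> k *\<^sub>m (TW_A l1 l2 l3 ** TW_B l1 l2 l3)) \<and>
        (l1 + l2) * (l1 + l3) * (l2 + l3) = 0 \<and>
        factors_over_SLB3 \<tau> \<and>
        (irreducible_rep B3 \<rho> \<longrightarrow>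
          (\<exists>m1 m2 m3 N. {#m1, m2, m3#} = {#l1, l2, l3#} \<and> invertible N \<and>
            is_TW_rep m1 m2 m3 (conj_rep N \<rho>) \<and>
            (\<exists>z \<epsilon>. z \<noteq> 0 \<and> \<epsilon> \<in> {1, -1} \<and>
              conj_rep N \<tau> (lb3_gen Ls1 \<otimes>\<^bsub>LB3\<^esub> lb3_gen Ls2) = sym_s1s2_mat z \<and>
              conj_rep N \<tau> (lb3_gen Ls1) = \<epsilon> *\<^sub>m sym_s1_mat z) \<and>
            (\<forall>z \<epsilon>. z \<noteq> 0 \<and> \<epsilon> \<in> {1, -1} \<longrightarrow>
              (\<exists>\<tau>'. extends_to_LB3 (conj_rep N \<rho>) \<tau>' \<and>
                \<tau>' (lb3_gen Ls1 \<otimes>\<^bsub>LB3\<^esub> lb3_gen Ls2) = sym_s1s2_mat z \<and>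
                \<tau>' (lb3_gen Ls1) = \<epsilon> *\<^sub>m sym_s1_mat z))))))"
proof -
  note nz = assms(1-3)
  let ?A = "TW_A l1 l2 l3" and ?B = "TW_B l1 l2 l3"
  let ?S = "lb3_gen Ls1 \<otimes>\<^bsub>LB3\<^esub> lb3_gen Ls2"
  have \<rho>: "\<rho> (b3_gen B\<sigma>1) = ?A" "\<rho> (b3_gen B\<sigma>2) = ?B"
    using assms(6) by (simp_all add: is_TW_rep_def)
  obtain s S where "loop_braid_relations ?A ?B s S"
    using TW_exists_loop_braid_relations[OF nz assms(4,5)] by blast
  then have ex: "\<exists>\<tau>. extends_to_LB3 \<rho> \<tau>"
    using extends_if_loop_braid_relations[of \<rho> s S] invertible_TW_A[OF nz] invertible_TW_B[OF nz]
      TW_braid[OF nz] \<rho> by auto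
  show ?thesis
  proof (intro conjI ex allI impI, goal_cases)
    case (1 \<tau>)
    note rels = loop_braid_relations_if_extends(1)[OF 1, unfolded \<rho>]
    show ?case
    proof (cases "\<exists>k. \<tau> ?S = k *\<^sub>m (?A ** ?B)")
      case True
      then obtain k where "\<tau> ?S = k *\<^sub>m (?A ** ?B)" ..
      from scalar_quotient_normal_form[OF nz assms(4,5) rels this] show ?thesis by (rule disjI1)
    next
      case False
      then have S: "\<tau> ?S \<noteq> k *\<^sub>m (?A ** ?B)" for k by blast
      note q = TW_nonscalar_quotient[OF nz rels S]
      have "factors_over_SLB3 \<tau>"
        using factors_over_SLB3_if[of \<tau>] TW_factors_over_SLB3[OF nz rels q(2)] 1 \<rho>
          loop_braid_relations_if_extends(3)[OF 1] by (simp add: extends_to_LB3_def)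
      then show ?thesis
        using S q(1) irreducible_nonscalar_quotient[OF nz assms(6) 1 _ q(1) S]
        by (intro disjI2 conjI allI impI)
    qed
  qed
qed

end
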